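(* Let $q$ be a prime power, let $t,\alpha$ be integers with $0\le t\le q$ and $0\le\alpha<q$, and let $\mathcal K$ be a set of $qt+\alpha$ points of $\mathrm{PG}(2,q)$. Let $\mathfrak F$ be the set of lines of $\mathrm{PG}(2,q)$ meeting $\mathcal K$ in at least one point, and put $m_0=\min\{|\ell\cap\mathcal K|:\ell\in\mathfrak F\}$ and $M_0=\max\{|\ell\cap\mathcal K|:\ell\in\mathfrak F\}$. Let $\Gamma$ be a plane algebraic curve over $\overline{\mathrm{GF}(q)}$ of minimal degree among the plane algebraic curves passing through all the points of $\mathcal K$. If $$q>8t^3-16t^2+2t+4-2m_0(2t^2-5t+2)+2M_0(2t-1),$$ then $\deg\Gamma\ge 2t$. If $q$ is prime, the same conclusion $\deg\Gamma\ge 2t$ holds under the weaker condition $$q>8t^2-16t+8-2\alpha+2M_0(2t-1).$$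
   Context: $\overline{\mathrm{GF}(q)}$ denotes the algebraic closure of $\mathrm{GF}(q)$; a plane algebraic curve over it is the zero locus of a homogeneous polynomial with coefficients in $\overline{\mathrm{GF}(q)}$, and it passes through a point of $\mathrm{PG}(2,q)$ if that point lies on it. *)

theory Defs
  imports
    "HOL-Analysis.Analysis"
    "HOL-Algebra.Algebraic_Closure_Type"
    "HOL-Library.Poly_Mapping"
    "HOL-Computational_Algebra.Primes"
begin

(* The projective plane over a field: points are the one-dimensional subspaces of the
   three-dimensional coordinate space, and a line is the set of points contained in a
   two-dimensional subspace. *)

definition pg2_points :: "('k::field ^ 3) set set" where
  "pg2_points = {P. vec.subspace P \<and> vec.dim P = 1}"

definition pg2_lines :: "('k::field ^ 3) set set set" where
  "pg2_lines = {{P \<in> pg2_points. P \<subseteq> W} | W. vec.subspace W \<and> vec.dim W = 2}"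

definition lines_meeting :: "('k::field ^ 3) set set \<Rightarrow> ('k ^ 3) set set set" where
  "lines_meeting K = {l \<in> pg2_lines. l \<inter> K \<noteq> {}}"

(* m_0 and M_0; only meaningful for nonempty finite K, as Min and Max of the empty set
   are unspecified. *)

definition min_secant :: "('k::field ^ 3) set set \<Rightarrow> nat" where
  "min_secant K = Min ((\<lambda>l. card (l \<inter> K)) ` lines_meeting K)"

definition max_secant :: "('k::field ^ 3) set set \<Rightarrow> nat" where
  "max_secant K = Max ((\<lambda>l. card (l \<inter> K)) ` lines_meeting K)"

(* A monomial is its exponent vector, of type 3 =>0 nat. *)

type_synonym 'k ternary_poly = "(3 \<Rightarrow>\<^sub>0 nat) \<Rightarrow>\<^sub>0 'k"

definition eval_poly3 :: "'k::field ternary_poly \<Rightarrow> 'k ^ 3 \<Rightarrow> 'k" where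
  "eval_poly3 F x =
     (\<Sum>m\<in>Poly_Mapping.keys F.
        Poly_Mapping.lookup F m * (\<Prod>i\<in>UNIV. (x $ i) ^ Poly_Mapping.lookup m i))"

(* The zero polynomial is excluded, so that the degree d is determined by F. *)

definition form_of_degree :: "nat \<Rightarrow> 'k::field ternary_poly \<Rightarrow> bool" where
  "form_of_degree d F \<longleftrightarrow>
     F \<noteq> 0 \<and> (\<forall>m\<in>Poly_Mapping.keys F. (\<Sum>i\<in>UNIV. Poly_Mapping.lookup m i) = d)"

definition zero_locus :: "'k::field ternary_poly \<Rightarrow> ('k ^ 3) set set" where
  "zero_locus F = {P \<in> pg2_points. \<forall>x\<in>P. eval_poly3 F x = 0}"

definition plane_curve :: "('k::field ^ 3) set set \<Rightarrow> bool" where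
  "plane_curve C \<longleftrightarrow> (\<exists>d F. d \<ge> 1 \<and> form_of_degree d F \<and> C = zero_locus F)"

(* Many forms (e.g. all powers of F) have the same zero locus; the degree of a curve is the
   degree of a defining form without superfluous factors, i.e. the least possible one. *)

definition curve_degree :: "('k::field ^ 3) set set \<Rightarrow> nat" where
  "curve_degree C = (LEAST d. d \<ge> 1 \<and> (\<exists>F. form_of_degree d F \<and> C = zero_locus F))"

(* A point of PG(2,k), seen as a point of the plane over the algebraic closure of k. *)

definition point_to_ac :: "('k::field ^ 3) set \<Rightarrow> ('k alg_closure ^ 3) set" where
  "point_to_ac P = vec.span ((\<lambda>v. \<chi> i. to_ac (v $ i)) ` P)"

definition passes_through ::
  "('k::field alg_closure ^ 3) set set \<Rightarrow> ('k ^ 3) set \<Rightarrow> bool" where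
  "passes_through C P \<longleftrightarrow> point_to_ac P \<in> C"

end

theory Submission
  imports Defs
begin

text \<open>
  Let \<open>f\<close> be an affine equation, of degree at most \<open>2t - 1\<close>, of a curve through \<open>K\<close>, and let \<open>e\<close> be the
  degree of one of its irreducible components \<open>C\<close>, with equation \<open>g\<close>. The curve
  \<open>(x^q - x) g_x + (y^q - y) g_y = 0\<close> of degree at most \<open>e + q - 1\<close> meets \<open>C\<close> with multiplicity at least two
  at every rational point, so, unless it contains \<open>C\<close>, Bezout's theorem leaves room for at most
  \<open>e (e + q - 1) / 2\<close> rational points (Stoehr and Voloch). If it does contain \<open>C\<close> and \<open>e > 1\<close>, then the
  polar of a rational point \<open>P\<close>, of degree \<open>e - 1\<close>, meets \<open>C\<close> at \<open>P\<close> with multiplicity at least \<open>q\<close>, and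
  \<open>q \<le> e (e - 1)\<close> unless \<open>C\<close> has at most one rational point. Lines, including the line at infinity,
  carry at most \<open>M\<^sub>0\<close> points of \<open>K\<close>. Summing over the components gives fewer than \<open>qt + \<alpha>\<close> points.
  Bezout's theorem is only needed in the form that \<open>k[x, y] / (f, g)\<close> has dimension at most
  \<open>deg f deg g\<close>.
\<close>

text \<open>No intersection multiplicity is ever defined: a contact of order r at a point is
  witnessed by r polynomials that are linearly independent modulo the ideal of the two curves, and
  the dimension bound counts them. For double contacts they form a dual system to values and
  tangential derivatives; for contact of order q they are powers of a linear form vanishing at the
  point. Each component of degree e is charged at most e (d + q - 1) / 2 points with d = 2t - 1
  fixed, so the charges add up like the degrees whatever the factorisation; lines fit in because 2
  M_0 \<le> d + q - 1. The line at infinity costs a further M_0, and the total stays below |K|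
  exactly when (2t - 1)(2t - 2) + 2 M_0 < q + 2 \<alpha>. The exceptional point of a nonclassical
  component is one whose polar contains the component, so that all tangents pass through it; two
  such points would force both partial derivatives to vanish, and over an algebraically closed field
  of characteristic p the equation would be a p-th power.\<close>

hide_const (open) Polynomials.degree up_ring.coeff up_ring.monom
  Polynomials.lead_coeff module.smult Divisibility.prime Divisibility.irreducible UnivPoly.deg Coset.order

section \<open>Bivariate polynomials\<close>

text \<open>This is p(a + u t), with t as the outer and u as the inner variable.\<close>

definition blowup_x :: "'a::comm_ring_1 \<Rightarrow> 'a poly \<Rightarrow> 'a poly poly" where
  "blowup_x a p = poly (map_poly (\<lambda>c. [:[:c:]:]) p) [:[:a:], [:0, 1:]:]"

text \<open>\<open>blowup a b f\<close> is \<open>f(a + u t, b + t)\<close> as a polynomial in \<open>t\<close> over polynomials in \<open>u\<close>. Its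
  \<open>t\<close>-degree is the total degree of \<open>f\<close>, its \<open>t\<close>-order the multiplicity of \<open>f\<close> at \<open>(a, b)\<close>, so that both
  become additive because degrees and orders of univariate polynomials are.\<close>

definition blowup :: "'a::comm_ring_1 \<Rightarrow> 'a \<Rightarrow> 'a poly poly \<Rightarrow> 'a poly poly" where
  "blowup a b f = poly (map_poly (blowup_x a) f) [:[:b:], 1:]"

definition ev2 :: "'a::comm_ring_1 poly poly \<Rightarrow> 'a \<Rightarrow> 'a \<Rightarrow> 'a" where
  "ev2 f a b = poly (poly f [:b:]) a"

definition vx :: "'a::comm_ring_1 poly poly" where "vx = [:[:0, 1:]:]"
definition vy :: "'a::comm_ring_1 poly poly" where "vy = [:0, 1:]"

text \<open>With the next lemma: a homomorphism of the coefficients together with a value for the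
  variable gives a ring homomorphism. All substitutions below, \<open>blowup\<close> in particular,
  are of this shape.\<close>

lemma poly_map_poly_add:
  fixes h :: "'a::comm_ring_1 \<Rightarrow> 'b::comm_ring_1"
  assumes h: "h 0 = 0" "\<And>x y. h (x + y) = h x + h y"
  shows "poly (map_poly h (p + q)) y = poly (map_poly h p) y + poly (map_poly h q) y"
proof (induction p q rule: poly_induct2)
  case (pCons a p b q)
  then show ?case by (simp add: map_poly_pCons h algebra_simps)
qed simp

lemma poly_map_poly_mult:
  fixes h :: "'a::comm_ring_1 \<Rightarrow> 'b::comm_ring_1"
  assumes h: "h 0 = 0" "\<And>x y. h (x + y) = h x + h y" "\<And>x y. h (x * y) = h x * h y"
  shows "poly (map_poly h (p * q)) y = poly (map_poly h p) y * poly (map_poly h q) y"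
proof -
  have sm: "poly (map_poly h (Polynomial.smult c q)) y = h c * poly (map_poly h q) y" for c q
    by (induction q) (simp_all add: map_poly_pCons h algebra_simps)
  show ?thesis
    by (induction p) (simp_all add: map_poly_pCons h poly_map_poly_add[OF h(1,2)] sm algebra_simps)
qed

lemma blowup_x_simps [simp]:
  "blowup_x a 0 = 0" "blowup_x a 1 = 1"
  "blowup_x a (p + q) = blowup_x a p + blowup_x a q"
  "blowup_x a (p * q) = blowup_x a p * blowup_x a q"
  unfolding blowup_x_def
  by (simp_all add: poly_map_poly_add poly_map_poly_mult map_poly_pCons one_pCons)

lemma blowup_x_pCons: "blowup_x a (pCons c p) = [:[:c:]:] + [:[:a:], [:0, 1:]:] * blowup_x a p"
  by (simp add: blowup_x_def map_poly_pCons)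

lemma blowup_pCons: "blowup a b (pCons p f) = blowup_x a p + [:[:b:], 1:] * blowup a b f"
  by (simp add: blowup_def map_poly_pCons)

lemma blowup_simps [simp]:
  "blowup a b 0 = 0" "blowup a b 1 = 1"
  "blowup a b (f + g) = blowup a b f + blowup a b g"
  "blowup a b (f * g) = blowup a b f * blowup a b g"
  unfolding blowup_def
  by (simp_all add: poly_map_poly_add poly_map_poly_mult map_poly_pCons one_pCons blowup_x_pCons)

lemma blowup_const [simp]: "blowup a b [:[:c:]:] = [:[:c:]:]"
  by (simp add: blowup_pCons blowup_x_pCons)

lemma blowup_smult [simp]: "blowup a b (Polynomial.smult [:c:] f) = Polynomial.smult [:c:] (blowup a b f)"
  using blowup_simps(4)[of a b "[:[:c:]:]" f] by (simp del: blowup_simps)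

lemma blowup_uminus [simp]: "blowup a b (- f) = - blowup a b f"
  using blowup_simps(3)[of a b "- f" f] by (simp add: eq_neg_iff_add_eq_0 del: blowup_simps(3))

lemma blowup_diff [simp]: "blowup a b (f - g) = blowup a b f - blowup a b g"
  using blowup_simps(3)[of a b f "- g"] by (simp del: blowup_simps)

lemma blowup_power [simp]: "blowup a b (f ^ n) = blowup a b f ^ n"
  by (induction n) simp_all

lemma blowup_sum: "blowup a b (sum f A) = (\<Sum>i\<in>A. blowup a b (f i))"
  by (induction A rule: infinite_finite_induct) simp_all

lemma ev2_simps [simp]:
  "ev2 0 a b = 0" "ev2 1 a b = 1" "ev2 (f + g) a b = ev2 f a b + ev2 g a b"
  "ev2 (f * g) a b = ev2 f a b * ev2 g a b" "ev2 (- f) a b = - ev2 f a b"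
  "ev2 (f - g) a b = ev2 f a b - ev2 g a b" "ev2 (f ^ n) a b = ev2 f a b ^ n"
  "ev2 (Polynomial.smult [:c:] f) a b = c * ev2 f a b" "ev2 [:[:c:]:] a b = c"
  "ev2 vx a b = a" "ev2 vy a b = b"
  by (simp_all add: ev2_def vx_def vy_def)

lemma ev2_sum: "ev2 (sum f A) a b = (\<Sum>i\<in>A. ev2 (f i) a b)"
  by (simp add: ev2_def poly_sum)

lemma ev2_prod: "ev2 (prod f A) a b = (\<Prod>i\<in>A. ev2 (f i) a b)"
  by (simp add: ev2_def poly_prod)

lemma ev2_blowup: "ev2 (blowup a b f) u t = ev2 f (a + u * t) (b + t)"
proof -
  have x: "ev2 (blowup_x a p) u t = poly p (a + u * t)" for p
    by (induction p) (simp_all add: blowup_x_pCons ev2_def algebra_simps)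
  show ?thesis
    by (induction f) (simp_all add: blowup_pCons x algebra_simps, simp_all add: ev2_def algebra_simps)
qed

lemma coeff_blowup_x_0: "Polynomial.coeff (blowup_x 0 p) n = Polynomial.monom (Polynomial.coeff p n) n"
  by (induction p arbitrary: n)
     (auto simp: blowup_x_pCons Polynomial.coeff_pCons Polynomial.monom_Suc Polynomial.monom_0 split: nat.splits)

text \<open>The substitution sends x^i y^j to u^i t^(i + j). The t^n coefficient is thus the
  homogeneous part of degree n, written in u = x / y, and no two monomials collide.\<close>

lemma coeff_blowup_0:
  "Polynomial.coeff (Polynomial.coeff (blowup 0 0 f) n) i = (if i \<le> n then Polynomial.coeff (Polynomial.coeff f (n - i)) i else 0)"
proof (induction f arbitrary: n)
  case (pCons p f)
  show ?case
    by (cases n)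
       (auto simp: blowup_pCons coeff_blowup_x_0 pCons.IH Suc_diff_le le_Suc_eq Polynomial.coeff_pCons
             split: nat.splits)
qed simp

section \<open>Total degree\<close>

definition tdeg :: "'a::comm_ring_1 poly poly \<Rightarrow> nat" where
  "tdeg f = Polynomial.degree (blowup 0 0 f)"

text \<open>\<open>cf f i j\<close> is the coefficient of \<open>x^i y^j\<close>: the inner variable of \<^typ>\<open>'a poly poly\<close> is \<open>x\<close>.\<close>

abbreviation cf :: "'a::zero poly poly \<Rightarrow> nat \<Rightarrow> nat \<Rightarrow> 'a" where
  "cf f i j \<equiv> Polynomial.coeff (Polynomial.coeff f j) i"

lemma bipoly_eqI: "(\<And>i j. cf f i j = cf g i j) \<Longrightarrow> f = g"
  by (simp add: poly_eq_iff)

lemma blowup_0_eq_0_iff [simp]: "blowup 0 0 f = 0 \<longleftrightarrow> f = 0"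
proof
  assume "blowup 0 0 f = 0"
  then have "cf f i j = 0" for i j
    using coeff_blowup_0[of f "i + j" i] by simp
  then show "f = 0" by (intro bipoly_eqI) simp
qed simp

lemma tdeg_le_iff: "tdeg f \<le> m \<longleftrightarrow> (\<forall>i j. m < i + j \<longrightarrow> cf f i j = 0)"
proof
  assume *: "tdeg f \<le> m"
  show "\<forall>i j. m < i + j \<longrightarrow> cf f i j = 0"
  proof (intro allI impI)
    fix i j assume "m < i + j"
    then have "Polynomial.coeff (blowup 0 0 f) (i + j) = 0"
      using * by (intro coeff_eq_0) (simp add: tdeg_def)
    then show "cf f i j = 0"
      using coeff_blowup_0[of f "i + j" i] by simp
  qed
next
  assume *: "\<forall>i j. m < i + j \<longrightarrow> cf f i j = 0"
  show "tdeg f \<le> m"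
    unfolding tdeg_def
  proof (rule degree_le, intro allI impI)
    fix n assume "m < n"
    show "Polynomial.coeff (blowup 0 0 f) n = 0"
    proof (rule poly_eqI)
      fix i show "cf (blowup 0 0 f) i n = Polynomial.coeff 0 i"
        using * \<open>m < n\<close> by (simp add: coeff_blowup_0)
    qed
  qed
qed

lemma tdeg_mult:
  fixes f g :: "'a::idom poly poly"
  shows "f \<noteq> 0 \<Longrightarrow> g \<noteq> 0 \<Longrightarrow> tdeg (f * g) = tdeg f + tdeg g"
  by (simp add: tdeg_def Polynomial.degree_mult_eq)

lemma tdeg_mult_le:
  fixes f g :: "'a::idom poly poly"
  shows "tdeg (f * g) \<le> tdeg f + tdeg g"
  by (simp add: tdeg_def Polynomial.degree_mult_le)

lemma tdeg_add_le: "tdeg f \<le> m \<Longrightarrow> tdeg g \<le> m \<Longrightarrow> tdeg (f + g) \<le> m"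
  by (simp add: tdeg_def Polynomial.degree_add_le)

lemma tdeg_diff_le: "tdeg f \<le> m \<Longrightarrow> tdeg g \<le> m \<Longrightarrow> tdeg (f - g) \<le> m"
  by (simp add: tdeg_def Polynomial.degree_diff_le)

lemma tdeg_dvd_less:
  fixes f g :: "'a::idom poly poly"
  assumes "f dvd g" "tdeg g < tdeg f"
  shows "g = 0"
  using assms tdeg_mult by (metis dvd_def le_add1 mult_zero_left mult_zero_right not_less)

lemma tdeg_0_const:
  assumes "tdeg f = 0"
  shows "f = [:[:cf f 0 0:]:]"
proof (rule bipoly_eqI)
  fix i j
  show "cf f i j = cf [:[:cf f 0 0:]:] i j"
    using assms tdeg_le_iff[of f 0] by (auto simp: Polynomial.coeff_pCons split: nat.splits)
qed

lemma tdeg_prime_pos: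
  fixes f :: "'a::field poly poly"
  assumes "prime_elem f"
  shows "0 < tdeg f"
proof (rule ccontr)
  assume "\<not> 0 < tdeg f"
  then have f: "f = [:[:cf f 0 0:]:]"
    using tdeg_0_const by blast
  have "f \<noteq> 0" "\<not> is_unit f"
    using assms by (auto simp: prime_elem_def)
  moreover have "is_unit f" if "f \<noteq> 0"
  proof -
    have "cf f 0 0 \<noteq> 0"
      using f that by auto
    then have "is_unit [:[:cf f 0 0:]:]"
      by (simp add: is_unit_const_poly_iff dvd_field_iff)
    then show ?thesis
      using f by simp
  qed
  ultimately show False by blast
qed

section \<open>A dimension bound of Bezout type\<close>

definition mono2 :: "nat \<times> nat \<Rightarrow> 'a::comm_ring_1 poly poly" where
  "mono2 = (\<lambda>(i, j). Polynomial.monom (Polynomial.monom 1 i) j)"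

definition exponents :: "nat \<Rightarrow> (nat \<times> nat) set" where
  "exponents m = {(i, j). i + j \<le> m}"

lemma finite_exponents [simp]: "finite (exponents m)"
  by (rule finite_subset[of _ "{..m} \<times> {..m}"]) (auto simp: exponents_def)

lemma card_exponents: "2 * card (exponents m) = (m + 1) * (m + 2)"
proof -
  have "exponents m = (\<Union>i\<le>m. {i} \<times> {..m - i})"
    by (auto simp: exponents_def)
  then have "card (exponents m) = (\<Sum>i\<le>m. card ({i} \<times> {..m - i}))"
    by (simp add: card_UN_disjoint disjoint_iff)
  also have "\<dots> = (\<Sum>i\<le>m. Suc (m - i))"
    by (simp add: card_cartesian_product)
  also have "\<dots> = (\<Sum>i\<le>m. Suc i)"
    by (rule sum.reindex_bij_witness[of _ "\<lambda>i. m - i" "\<lambda>i. m - i"]) auto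
  finally have "card (exponents m) = (\<Sum>i\<le>m. Suc i)" .
  moreover have "2 * (\<Sum>i\<le>m. Suc i) = (m + 1) * (m + 2)"
    by (induction m) simp_all
  ultimately show ?thesis
    by simp
qed

lemma cf_mono2_sum:
  assumes "finite A"
  shows "cf (\<Sum>x\<in>A. Polynomial.smult [:c x:] (mono2 x)) i j = (if (i, j) \<in> A then c (i, j) else 0)"
proof -
  have "cf (\<Sum>x\<in>A. Polynomial.smult [:c x:] (mono2 x)) i j = (\<Sum>x\<in>A. if x = (i, j) then c (i, j) else 0)"
    unfolding Polynomial.coeff_sum
    by (intro sum.cong) (auto simp: mono2_def split: prod.splits)
  then show ?thesis
    using assms by (simp add: sum.delta)
qed

lemma tdeg_le_expand:
  assumes "tdeg f \<le> m"
  shows "f = (\<Sum>x\<in>exponents m. Polynomial.smult [:cf f (fst x) (snd x):] (mono2 x))"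
proof (rule bipoly_eqI)
  fix i j
  show "cf f i j = cf (\<Sum>x\<in>exponents m. Polynomial.smult [:cf f (fst x) (snd x):] (mono2 x)) i j"
    using assms by (subst cf_mono2_sum[OF finite_exponents]) (auto simp: tdeg_le_iff exponents_def not_le)
qed

lemma tdeg_mono2_le: "tdeg (mono2 (i, j)) \<le> i + j"
  unfolding tdeg_le_iff mono2_def by (auto split: if_splits)

lemma tdeg_sum_le: "(\<And>x. x \<in> A \<Longrightarrow> tdeg (f x) \<le> m) \<Longrightarrow> tdeg (sum f A) \<le> m"
  by (induction A rule: infinite_finite_induct) (auto intro!: tdeg_add_le simp: tdeg_le_iff)

text \<open>The family lies in the span of the monomials of degree at most \<open>m\<close>. It is
  indexed so that a disjoint union of several kinds of polynomials can be inserted; its injectivity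
  is a consequence of independence.\<close>

lemma card_le_of_independent_family:
  fixes v :: "'i \<Rightarrow> 'a::field poly poly"
  assumes "finite I" and deg: "\<And>i. i \<in> I \<Longrightarrow> tdeg (v i) \<le> m"
    and indep: "\<And>c. (\<Sum>i\<in>I. Polynomial.smult [:c i:] (v i)) = 0 \<Longrightarrow> \<forall>i\<in>I. c i = 0"
  shows "card I \<le> card (exponents m)"
proof -
  interpret V: vector_space "\<lambda>(c::'a) (f::'a poly poly). Polynomial.smult [:c:] f"
    by unfold_locales (simp_all add: smult_add_right mult.commute flip: one_pCons smult_add_left)
  have inj: "inj_on v I"
  proof (rule inj_onI, rule ccontr)
    fix x y assume xy: "x \<in> I" "y \<in> I" "v x = v y" "x \<noteq> y"
    define c where "c = (\<lambda>i. if i = x then 1 else if i = y then - 1 else (0::'a))"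
    have "(\<Sum>i\<in>I. Polynomial.smult [:c i:] (v i)) = (\<Sum>i\<in>{x, y}. Polynomial.smult [:c i:] (v i))"
      using xy \<open>finite I\<close> by (intro sum.mono_neutral_right) (auto simp: c_def)
    also have "\<dots> = 0"
      using xy by (simp add: c_def flip: one_pCons)
    finally show False
      using indep[of c] xy by (auto simp: c_def)
  qed
  have "V.independent (v ` I)"
  proof (rule V.independent_if_scalars_zero)
    fix f x assume "(\<Sum>x\<in>v ` I. Polynomial.smult [:f x:] x) = 0" "x \<in> v ` I"
    then show "f x = 0"
      using indep[of "f \<circ> v"] inj by (auto simp: sum.reindex)
  qed (use \<open>finite I\<close> in simp)
  moreover have "v ` I \<subseteq> V.span (mono2 ` exponents m)"
  proof safe
    fix i assume "i \<in> I"
    show "v i \<in> V.span (mono2 ` exponents m)"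
      by (subst tdeg_le_expand[OF deg[OF \<open>i \<in> I\<close>]]) (intro V.span_sum V.span_scale V.span_base imageI)
  qed
  ultimately have "card (v ` I) \<le> card (mono2 ` exponents m :: 'a poly poly set)"
    using V.independent_span_bound[of "mono2 ` exponents m" "v ` I"] by simp
  also have "\<dots> \<le> card (exponents m)"
    by (rule card_image_le) simp
  finally show ?thesis
    using inj by (simp add: card_image)
qed

text \<open>The second difference of (m + 1)(m + 2) / 2 with steps \<open>d\<close> and
  \<open>n\<close> is \<open>d * n\<close>; \<open>d + n \<le> m\<close> keeps the natural
  subtractions exact.\<close>

lemma bezout_dim_arith:
  assumes "a + (b - b') + r \<le> c"
    "2 * a = (m - d + 1) * (m - d + 2)" "2 * b = (m - n + 1) * (m - n + 2)"
    "2 * b' = (m - n - d + 1) * (m - n - d + 2)" "2 * c = (m + 1) * (m + 2)" "d + n \<le> m" "b' \<le> b"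
  shows "r \<le> d * (n::nat)"
proof -
  obtain k where m: "m = d + n + k"
    using assms(6) le_Suc_ex by blast
  have "2 * int a + 2 * int b - 2 * int b' + 2 * int r \<le> 2 * int c"
    using assms(1,7) by linarith
  moreover have "2 * int a = int ((m - d + 1) * (m - d + 2))" "2 * int b = int ((m - n + 1) * (m - n + 2))"
     "2 * int b' = int ((m - n - d + 1) * (m - n - d + 2))" "2 * int c = int ((m + 1) * (m + 2))"
    using assms(2-5) by linarith+
  ultimately have "2 * int r \<le> 2 * (int d * int n)"
    by (simp add: m algebra_simps)
  then show ?thesis
    by (metis mult_le_cancel_left_pos of_nat_le_iff of_nat_mult zero_less_numeral)
qed

text \<open>The multiples of \<open>f\<close>, the products of \<open>g\<close> with monomials not divisible by the leading monomial of
  \<open>f\<close>, and the \<open>s k\<close> are independent; counting monomials of large degree \<open>m\<close> gives the bound.\<close>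

lemma bezout_dim:
  fixes f g :: "'a::field poly poly" and s :: "'s \<Rightarrow> 'a poly poly"
  assumes prime: "prime_elem f" and ndvd: "\<not> f dvd g" and "finite S"
    and indep: "\<And>c a b. (\<Sum>k\<in>S. Polynomial.smult [:c k:] (s k)) = a * f + b * g \<Longrightarrow> \<forall>k\<in>S. c k = 0"
  shows "card S \<le> tdeg f * tdeg g"
proof -
  define d n where "d = tdeg f" and "n = tdeg g"
  \<comment> \<open>Monomials are ordered by total degree, then by the exponent of x. The leading
    monomial of \<open>f\<close> is x^i y^(d - i) with i = \<open>i\<^sub>0\<close>.\<close>
  define i\<^sub>0 where "i\<^sub>0 = Polynomial.degree (Polynomial.lead_coeff (blowup 0 0 f))"
  \<comment> \<open>Large enough to contain every \<open>s k\<close> and to make the count of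
    monomials a polynomial in the degrees.\<close>
  define m where "m = d + n + (\<Sum>k\<in>S. tdeg (s k))"
  have [simp]: "f \<noteq> 0" "g \<noteq> 0"
    using prime ndvd by auto
  have dnm: "d + n \<le> m" by (simp add: m_def)
  have lc_deg: "Polynomial.degree (Polynomial.lead_coeff (blowup 0 0 h)) \<le> tdeg h" for h :: "'a poly poly"
    by (rule degree_le) (simp add: coeff_blowup_0 tdeg_def)
  have i0: "i\<^sub>0 \<le> d"
    unfolding i\<^sub>0_def d_def by (rule lc_deg)
  define A where "A = exponents (m - d)"
  \<comment> \<open>Exponents divisible by the leading monomial of \<open>f\<close>; leaving them
    out avoids counting the multiples of \<open>f * g\<close> twice.\<close>
  define D where "D = (\<lambda>(i, j). (i + i\<^sub>0, j + (d - i\<^sub>0))) ` exponents (m - n - d)"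
  define B where "B = exponents (m - n) - D"
  have D: "D \<subseteq> exponents (m - n)"
    using dnm i0 by (auto simp: D_def exponents_def)
  have inB: "\<not> (i\<^sub>0 \<le> i \<and> d - i\<^sub>0 \<le> j)" if "(i, j) \<in> B" for i j
  proof
    assume "i\<^sub>0 \<le> i \<and> d - i\<^sub>0 \<le> j"
    moreover have "i + j \<le> m - n"
      using that by (simp add: B_def exponents_def)
    ultimately have "(i, j) \<in> D"
      unfolding D_def using i0
      by (intro image_eqI[of _ _ "(i - i\<^sub>0, j - (d - i\<^sub>0))"]) (auto simp: exponents_def)
    with that show False by (simp add: B_def)
  qed
  have [simp]: "finite A" "finite B"
    by (simp_all add: A_def B_def)
  have cardD: "card D = card (exponents (m - n - d))"
    unfolding D_def by (rule card_image) (auto simp: inj_on_def)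
  have cardB: "card B = card (exponents (m - n)) - card D"
    unfolding B_def using D finite_subset[OF D] by (intro card_Diff_subset) auto
  define v :: "(nat \<times> nat) + (nat \<times> nat) + 's \<Rightarrow> 'a poly poly" where
    "v = case_sum (\<lambda>x. mono2 x * f) (case_sum (\<lambda>x. mono2 x * g) s)"
  have "card (A <+> (B <+> S)) \<le> card (exponents m)"
  proof (rule card_le_of_independent_family)
    show "finite (A <+> (B <+> S))"
      using \<open>finite S\<close> by simp
  next
    fix x assume "x \<in> A <+> (B <+> S)"
    then consider i j where "x = Inl (i, j)" "(i, j) \<in> A" | i j where "x = Inr (Inl (i, j))" "(i, j) \<in> B"
      | k where "x = Inr (Inr k)" "k \<in> S"
      by auto
    then show "tdeg (v x) \<le> m"
    proof cases
      case (1 i j)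
      have "tdeg (v x) \<le> tdeg (mono2 (i, j) :: 'a poly poly) + d"
        using tdeg_mult_le 1 by (simp add: v_def d_def)
      also have "\<dots> \<le> m"
        using tdeg_mono2_le[of i j, where ?'a = 'a] 1 dnm by (simp add: A_def exponents_def)
      finally show ?thesis .
    next
      case (2 i j)
      then have "i + j \<le> m - n" by (simp add: B_def exponents_def)
      have "tdeg (v x) \<le> tdeg (mono2 (i, j) :: 'a poly poly) + n"
        using tdeg_mult_le 2 by (simp add: v_def n_def)
      also have "\<dots> \<le> m"
        using tdeg_mono2_le[of i j, where ?'a = 'a] \<open>i + j \<le> m - n\<close> dnm by linarith
      finally show ?thesis .
    next
      case (3 k)
      then show ?thesis
        using member_le_sum[of k S "\<lambda>k. tdeg (s k)"] \<open>finite S\<close> by (simp add: v_def m_def)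
    qed
  next
    fix c :: "(nat \<times> nat) + (nat \<times> nat) + 's \<Rightarrow> 'a"
    define a where "a = (\<Sum>x\<in>A. Polynomial.smult [:c (Inl x):] (mono2 x))"
    define b where "b = (\<Sum>x\<in>B. Polynomial.smult [:c (Inr (Inl x)):] (mono2 x))"
    assume "(\<Sum>x\<in>A <+> (B <+> S). Polynomial.smult [:c x:] (v x)) = 0"
    then have eq: "a * f + b * g + (\<Sum>k\<in>S. Polynomial.smult [:c (Inr (Inr k)):] (s k)) = 0"
      using \<open>finite S\<close> by (simp add: sum.Plus v_def a_def b_def sum_distrib_right add.assoc)
    have c3: "\<forall>k\<in>S. c (Inr (Inr k)) = 0"
      by (rule indep[of _ "- a" "- b"]) (use eq in \<open>simp add: algebra_simps eq_neg_iff_add_eq_0\<close>)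
    with eq have abfg: "a * f + b * g = 0" by simp
    then have "f dvd b * g"
      by (metis add_eq_0_iff dvd_minus_iff dvd_triv_right)
    then have "f dvd b"
      using prime ndvd prime_elem_dvd_mult_iff by blast
    then obtain h where h: "b = f * h" by blast
    \<comment> \<open>Leading monomials multiply, so a nonzero multiple of \<open>f\<close> has one
      divisible by that of \<open>f\<close>, and \<open>B\<close> contains none of these.\<close>
    have b0: "b = 0"
    proof (rule ccontr)
      assume "b \<noteq> 0"
      then have "h \<noteq> 0" using h by auto
      define ib where "ib = Polynomial.degree (Polynomial.lead_coeff (blowup 0 0 b))"
      define ih where "ih = Polynomial.degree (Polynomial.lead_coeff (blowup 0 0 h))"
      have ib: "ib = i\<^sub>0 + ih"
        using \<open>h \<noteq> 0\<close>
        by (simp only: ib_def ih_def i\<^sub>0_def h blowup_simps Polynomial.lead_coeff_mult)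
           (simp add: Polynomial.degree_mult_eq)
      have tb: "tdeg b = d + tdeg h"
        using \<open>h \<noteq> 0\<close> by (simp add: h d_def tdeg_mult)
      have "cf (blowup 0 0 b) ib (tdeg b) \<noteq> 0"
        using \<open>b \<noteq> 0\<close> by (simp add: ib_def tdeg_def)
      then have "cf b ib (tdeg b - ib) \<noteq> 0"
        by (auto simp: coeff_blowup_0 split: if_splits)
      then have "(ib, tdeg b - ib) \<in> B"
        unfolding b_def by (subst (asm) cf_mono2_sum) (auto split: if_splits)
      moreover have "i\<^sub>0 \<le> ib \<and> d - i\<^sub>0 \<le> tdeg b - ib"
        using lc_deg[of h] i0 by (auto simp: ib tb ih_def)
      ultimately show False using inB by blast
    qed
    with abfg have a0: "a = 0" by simp
    have "c (Inl x) = 0" if "x \<in> A" for x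
      using cf_mono2_sum[of A "\<lambda>x. c (Inl x)" "snd x" "fst x"] that a0 by (simp add: a_def)
    moreover have "c (Inr (Inl x)) = 0" if "x \<in> B" for x
      using cf_mono2_sum[of B "\<lambda>x. c (Inr (Inl x))" "snd x" "fst x"] that b0 by (simp add: b_def)
    ultimately show "\<forall>x\<in>A <+> (B <+> S). c x = 0"
      using c3 by auto
  qed
  then have "card (exponents (m - d)) + (card (exponents (m - n)) - card (exponents (m - n - d))) + card S \<le> card (exponents m)"
    using \<open>finite S\<close> by (simp add: card_Plus cardB cardD A_def)
  then show ?thesis
    unfolding d_def[symmetric] n_def[symmetric]
    by (rule bezout_dim_arith) (use dnm card_mono[OF finite_exponents D] cardD in \<open>simp_all only: card_exponents\<close>)
qed

section \<open>Rational points on a Frobenius classical component\<close>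

definition dx :: "'a::idom poly poly \<Rightarrow> 'a poly poly" where "dx = map_poly pderiv"
definition dy :: "'a::idom poly poly \<Rightarrow> 'a poly poly" where "dy = pderiv"

lemma cf_dx: "cf (dx f) i j = of_nat (Suc i) * cf f (Suc i) j"
  by (simp add: dx_def coeff_map_poly coeff_pderiv)

lemma cf_dy: "cf (dy f) i j = of_nat (Suc j) * cf f i (Suc j)"
  by (simp add: dy_def coeff_pderiv of_nat_poly)

lemma dx_add [simp]: "dx (f + g) = dx f + dx g"
  by (intro bipoly_eqI) (simp add: cf_dx algebra_simps)

lemma dx_pCons: "dx (pCons p f) = pCons (pderiv p) (dx f)"
  by (simp add: dx_def map_poly_pCons)

lemma dx_mult [simp]: "dx (f * g) = dx f * g + f * dx g"
proof (induction f)
  case (pCons p f)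
  have smult: "dx (Polynomial.smult p g) = Polynomial.smult (pderiv p) g + Polynomial.smult p (dx g)"
  proof (induction g)
    case (pCons q g)
    then show ?case
      by (simp add: dx_pCons pderiv_mult)
  qed (simp add: dx_def)
  show ?case
    by (simp add: dx_pCons pCons.IH smult)
qed (simp add: dx_def)

lemma dy_add [simp]: "dy (f + g) = dy f + dy g"
  by (simp add: dy_def pderiv_add)

lemma dy_mult [simp]: "dy (f * g) = dy f * g + f * dy g"
  by (simp add: dy_def pderiv_mult)

lemma dx_diff [simp]: "dx (f - g) = dx f - dx g"
  using dx_add[of "f - g" g] by (simp del: dx_add)

lemma dy_diff [simp]: "dy (f - g) = dy f - dy g"
  by (simp add: dy_def pderiv_diff)

lemma d_const [simp]: "dx [:[:c:]:] = 0" "dy [:[:c:]:] = 0" "dx 1 = 0" "dy 1 = 0" "dx 0 = 0" "dy 0 = 0"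
  by (simp_all add: dx_def dy_def map_poly_pCons one_pCons)

lemma d_var [simp]: "dx vx = 1" "dy vx = 0" "dx vy = 0" "dy vy = 1"
  by (simp_all add: dx_def dy_def vx_def vy_def map_poly_pCons one_pCons pderiv_pCons)

lemma d_smult [simp]:
  "dx (Polynomial.smult [:c:] f) = Polynomial.smult [:c:] (dx f)"
  "dy (Polynomial.smult [:c:] f) = Polynomial.smult [:c:] (dy f)"
  using dx_mult[of "[:[:c:]:]" f] dy_mult[of "[:[:c:]:]" f] by (simp_all del: dx_mult dy_mult)

lemma d_sum: "dx (sum f A) = (\<Sum>i\<in>A. dx (f i))" "dy (sum f A) = (\<Sum>i\<in>A. dy (f i))"
  by (induction A rule: infinite_finite_induct) simp_all

lemma dx_power: "dx (f ^ n) = of_nat n * f ^ (n - 1) * dx f"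
proof (induction n)
  case (Suc n)
  then show ?case
    by (cases n) (simp_all add: algebra_simps)
qed simp

lemma dy_power: "dy (f ^ n) = of_nat n * f ^ (n - 1) * dy f"
proof (induction n)
  case (Suc n)
  then show ?case
    by (cases n) (simp_all add: algebra_simps)
qed simp

lemma tdeg_dx: "tdeg (dx f) \<le> tdeg f - 1"
  unfolding tdeg_le_iff using tdeg_le_iff[of f "tdeg f"] by (auto simp: cf_dx)

lemma tdeg_dy: "tdeg (dy f) \<le> tdeg f - 1"
  unfolding tdeg_le_iff using tdeg_le_iff[of f "tdeg f"] by (auto simp: cf_dy)

lemma tdeg_var [simp]: "tdeg (vx :: 'a::idom poly poly) = 1" "tdeg (vy :: 'a poly poly) = 1"
  by (simp_all add: tdeg_def vx_def vy_def blowup_pCons blowup_x_pCons)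

lemma tdeg_const [simp]: "tdeg [:[:c:]:] = 0" "tdeg 1 = 0" "tdeg 0 = 0"
  by (simp_all add: tdeg_def)

lemma tdeg_power: "f \<noteq> (0::'a::idom poly poly) \<Longrightarrow> tdeg (f ^ n) = n * tdeg f"
  by (induction n) (simp_all add: tdeg_mult)

lemma var_nonzero [simp]: "vx \<noteq> (0::'a::idom poly poly)" "vy \<noteq> (0::'a::idom poly poly)"
  by (simp_all add: vx_def vy_def)

lemma tdeg_mult_le': "tdeg f \<le> a \<Longrightarrow> tdeg g \<le> b \<Longrightarrow> tdeg (f * g) \<le> a + b" for f g :: "'a::idom poly poly"
  using tdeg_mult_le[of f g] by linarith

text \<open>On the curve its vanishing says that the image of the point under the q-th power map
  satisfies the equation of the tangent line at the point.\<close>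

definition frob_tangent :: "nat \<Rightarrow> 'a::idom poly poly \<Rightarrow> 'a poly poly" where
  "frob_tangent q f = (vx ^ q - vx) * dx f + (vy ^ q - vy) * dy f"

lemma tdeg_frob_tangent:
  assumes "0 < q" "0 < tdeg f"
  shows "tdeg (frob_tangent q f) \<le> tdeg f + q - 1"
proof -
  have "tdeg (frob_tangent q f) \<le> q + (tdeg f - 1)"
    unfolding frob_tangent_def
    by (intro tdeg_add_le tdeg_mult_le' tdeg_diff_le tdeg_dx tdeg_dy)
       (use assms in \<open>simp_all add: tdeg_power\<close>)
  with assms show ?thesis by simp
qed

definition double_zero :: "'a::idom poly poly \<Rightarrow> 'a \<times> 'a \<Rightarrow> bool" where
  "double_zero f = (\<lambda>(a, b). ev2 f a b = 0 \<and> ev2 (dx f) a b = 0 \<and> ev2 (dy f) a b = 0)"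

lemma double_zero_mult: "double_zero f P \<Longrightarrow> double_zero (f * g) P"
  by (auto simp: double_zero_def)

lemma double_zero_square: "ev2 l a b = 0 \<Longrightarrow> double_zero (l ^ 2) (a, b)"
  by (auto simp: double_zero_def power2_eq_square)

lemma exists_separating_line:
  assumes "P \<noteq> (R :: 'a::idom \<times> 'a)"
  shows "\<exists>l. ev2 l (fst R) (snd R) = 0 \<and> ev2 l (fst P) (snd P) \<noteq> 0"
proof (cases "fst P = fst R")
  case True
  then show ?thesis
    using assms by (intro exI[of _ "vy - [:[:snd R:]:]"]) (auto simp: prod_eq_iff)
next
  case False
  then show ?thesis
    by (intro exI[of _ "vx - [:[:fst R:]:]"]) auto
qed

text \<open>A product of squares of separating lines kills values and first derivatives at all the
  other points, so the functionals belonging to different points decouple.\<close>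

lemma exists_double_zero_separating:
  fixes N :: "('a::idom \<times> 'a) set"
  assumes "finite N"
  shows "\<exists>e. (\<forall>R\<in>N - {P}. double_zero e R) \<and> ev2 e (fst P) (snd P) \<noteq> 0"
proof -
  have "\<forall>R. \<exists>l. P \<noteq> R \<longrightarrow> ev2 l (fst R) (snd R) = 0 \<and> ev2 l (fst P) (snd P) \<noteq> 0"
    using exists_separating_line by blast
  then obtain l where l: "\<And>R. P \<noteq> R \<Longrightarrow> ev2 (l R) (fst R) (snd R) = 0"
    "\<And>R. P \<noteq> R \<Longrightarrow> ev2 (l R) (fst P) (snd P) \<noteq> 0"
    by metis
  define e where "e = (\<Prod>R\<in>N - {P}. l R ^ 2)"
  have "double_zero e R" if "R \<in> N - {P}" for R
  proof -
    have "e = l R ^ 2 * (\<Prod>R\<in>N - {P} - {R}. l R ^ 2)"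
      unfolding e_def using that assms by (intro prod.remove) auto
    moreover have "double_zero (l R ^ 2) R"
      using double_zero_square[of "l R" "fst R" "snd R"] l(1)[of R] that by auto
    ultimately show ?thesis
      using double_zero_mult by metis
  qed
  moreover have "ev2 e (fst P) (snd P) \<noteq> 0"
    unfolding e_def using assms l(2) by (auto simp: ev2_prod)
  ultimately show ?thesis by blast
qed

text \<open>At a rational point of the curve the gradient of \<open>frob_tangent q f\<close> is the negative of that of
  \<open>f\<close>, so the values and the derivatives along a common tangent vector are \<open>2 |N|\<close> independent
  functionals vanishing on the ideal of both.\<close>

lemma card_rational_points_classical:
  fixes f :: "'a::field poly poly"
  assumes prime: "prime_elem f" and q: "0 < q" "of_nat q = (0::'a)" and "finite N"
    and N: "\<And>a b. (a, b) \<in> N \<Longrightarrow> ev2 f a b = 0 \<and> a ^ q = a \<and> b ^ q = b"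
    and ndvd: "\<not> f dvd frob_tangent q f"
  shows "2 * card N \<le> tdeg f * (tdeg f + q - 1)"
proof -
  define g where "g = frob_tangent q f"
  \<comment> \<open>v is a nonzero tangent vector at the point, arbitrary if both partial
    derivatives vanish there; w is a covector with nonzero value on v, which yields a line that is
    not tangent in direction v.\<close>
  have "\<forall>P. \<exists>v w. ev2 (dx f) (fst P) (snd P) * fst v + ev2 (dy f) (fst P) (snd P) * snd v = 0
      \<and> fst w * fst v + snd w * snd v \<noteq> 0"
  proof
    fix P :: "'a \<times> 'a"
    define A B where "A = ev2 (dx f) (fst P) (snd P)" and "B = ev2 (dy f) (fst P) (snd P)"
    show "\<exists>v w. A * fst v + B * snd v = 0 \<and> fst w * fst v + snd w * snd v \<noteq> 0"
    proof (cases "A = 0")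
      case True
      then show ?thesis by (intro exI[of _ "(1, 0)"]) simp
    next
      case False
      then show ?thesis by (intro exI[of _ "(- B, A)"] exI[of _ "(0, 1)"]) simp
    qed
  qed
  then obtain v w where
    v: "\<And>P. ev2 (dx f) (fst P) (snd P) * fst (v P) + ev2 (dy f) (fst P) (snd P) * snd (v P) = 0"
    and w: "\<And>P. fst (w P) * fst (v P) + snd (w P) * snd (v P) \<noteq> 0"
    by metis
  obtain e where e: "\<And>P R. R \<in> N - {P} \<Longrightarrow> double_zero (e P) R" "\<And>P. ev2 (e P) (fst P) (snd P) \<noteq> 0"
    using exists_double_zero_separating[OF \<open>finite N\<close>] by metis
  define dv where "dv = (\<lambda>P h. ev2 (dx h) (fst P) (snd P) * fst (v P) + ev2 (dy h) (fst P) (snd P) * snd (v P))"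
  define l where "l = (\<lambda>P. Polynomial.smult [:fst (w P):] (vx - [:[:fst P:]:]) + Polynomial.smult [:snd (w P):] (vy - [:[:snd P:]:]))"
  \<comment> \<open>A triangular dual system: \<open>e P\<close> detects the value at
    \<open>P\<close>, and \<open>e P * l P\<close>, which vanishes there, detects the derivative
    along \<open>v P\<close>. Evaluation therefore has to remove \<open>c (P, False)\<close>
    first.\<close>
  define s where "s = (\<lambda>(P, b). if b then e P * l P else e P)"
  have l0: "ev2 (l P) (fst P) (snd P) = 0" for P
    by (simp add: l_def)
  have dvl: "dv P (l P) \<noteq> 0" for P
    using w[of P] by (simp add: dv_def l_def)
  have dv_mult: "dv P (h * k) = dv P h * ev2 k (fst P) (snd P) + ev2 h (fst P) (snd P) * dv P k" for P h k
    by (simp add: dv_def algebra_simps)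
  have dv_add: "dv P (h + k) = dv P h + dv P k" for P h k
    by (simp add: dv_def algebra_simps)
  have dv_sum: "dv P (sum h A) = (\<Sum>k\<in>A. dv P (h k))" for P and h :: "('a \<times> 'a) \<times> bool \<Rightarrow> _" and A
    by (simp add: dv_def d_sum ev2_sum sum.distrib sum_distrib_right)
  have dv_smult: "dv P (Polynomial.smult [:c:] h) = c * dv P h" for P c h
    by (simp add: dv_def algebra_simps)
  have g0: "ev2 g a b = 0" if "(a, b) \<in> N" for a b
    using N[OF that] by (simp add: g_def frob_tangent_def)
  have ofn: "ev2 (of_nat n) a b = of_nat n" for n and a b :: 'a
    by (induction n) simp_all
  \<comment> \<open>As q = 0 in the field, x^q - x has derivative -1, while its value at a rational
    point is 0.\<close>
  have gx: "ev2 (dx g) a b = - ev2 (dx f) a b" if "(a, b) \<in> N" for a b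
    using N[OF that] q by (simp add: g_def frob_tangent_def dx_power ofn)
  have gy: "ev2 (dy g) a b = - ev2 (dy f) a b" if "(a, b) \<in> N" for a b
    using N[OF that] q by (simp add: g_def frob_tangent_def dy_power ofn)
  have dvf: "dv P f = 0" for P
    using v[of P] by (simp add: dv_def)
  have dvg: "dv P g = 0" if "P \<in> N" for P
    using v[of P] gx[of "fst P" "snd P"] gy[of "fst P" "snd P"] that by (simp add: dv_def add_eq_0_iff)
  have "card (N \<times> (UNIV :: bool set)) \<le> tdeg f * tdeg g"
  proof (rule bezout_dim[OF prime, where s = s])
    show "\<not> f dvd g" using ndvd by (simp add: g_def)
    show "finite (N \<times> (UNIV :: bool set))" using \<open>finite N\<close> by simp
    fix c a b
    assume eq: "(\<Sum>k\<in>N \<times> UNIV. Polynomial.smult [:c k:] (s k)) = a * f + b * g"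
    have split: "(\<Sum>k\<in>N \<times> (UNIV :: bool set). h k) = h (P, True) + h (P, False)"
      if "P \<in> N" and "\<And>R b. R \<in> N - {P} \<Longrightarrow> h (R, b) = 0" for P and h :: "_ \<Rightarrow> 'a"
    proof -
      have "(\<Sum>k\<in>N \<times> (UNIV :: bool set). h k) = (\<Sum>k\<in>{(P, True), (P, False)}. h k)"
        using that \<open>finite N\<close> by (intro sum.mono_neutral_right) auto
      then show ?thesis by simp
    qed
    have dz: "double_zero (s (R, b)) P" if "P \<in> N" "R \<in> N - {P}" for P R b
      using e(1)[of P R] that by (auto simp: s_def intro: double_zero_mult)
    have dz1: "ev2 (s (R, b)) (fst P) (snd P) = 0" "dv P (s (R, b)) = 0" if "P \<in> N" "R \<in> N - {P}" for P R b
      using dz[OF that, of b] by (auto simp: double_zero_def dv_def split: prod.splits)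
    have s: "s (P, True) = e P * l P" "s (P, False) = e P" for P
      by (simp_all add: s_def)
    have "c (P, True) = 0 \<and> c (P, False) = 0" if "P \<in> N" for P
    proof -
      have "ev2 (\<Sum>k\<in>N \<times> UNIV. Polynomial.smult [:c k:] (s k)) (fst P) (snd P) = 0"
        unfolding eq using N[of "fst P" "snd P"] g0[of "fst P" "snd P"] that by simp
      also have "ev2 (\<Sum>k\<in>N \<times> UNIV. Polynomial.smult [:c k:] (s k)) (fst P) (snd P)
        = c (P, False) * ev2 (e P) (fst P) (snd P)"
        unfolding ev2_sum
        by (subst split[OF that]) (simp_all add: dz1[OF that] s l0)
      finally have cF: "c (P, False) = 0"
        using e(2)[of P] by simp
      have "dv P (\<Sum>k\<in>N \<times> UNIV. Polynomial.smult [:c k:] (s k)) = 0"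
        unfolding eq dv_add dv_mult
        using N[of "fst P" "snd P"] g0[of "fst P" "snd P"] that by (simp add: dvf dvg)
      also have "dv P (\<Sum>k\<in>N \<times> UNIV. Polynomial.smult [:c k:] (s k))
        = c (P, True) * (ev2 (e P) (fst P) (snd P) * dv P (l P))"
        unfolding dv_sum dv_smult
        by (subst split[OF that]) (simp_all add: dz1[OF that] s l0 cF dv_mult)
      finally show ?thesis
        using e(2)[of P] dvl[of P] cF by simp
    qed
    then show "\<forall>k\<in>N \<times> UNIV. c k = 0"
      by (metis (full_types) mem_Sigma_iff surj_pair)
  qed
  moreover have "card (N \<times> (UNIV :: bool set)) = 2 * card N"
    by (simp add: card_cartesian_product)
  moreover have "tdeg g \<le> tdeg f + q - 1"
    unfolding g_def using q tdeg_prime_pos[OF prime] by (intro tdeg_frob_tangent)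
  ultimately show ?thesis
    by (metis le_trans mult_le_mono2)
qed

section \<open>Rational points on a Frobenius nonclassical component\<close>

text \<open>Otherwise 1 plus the product of all x - c would be a nonconstant polynomial without
  roots.\<close>

lemma infinite_alg_closed_field: "infinite (UNIV :: 'a::alg_closed_field set)"
proof
  assume fin: "finite (UNIV :: 'a set)"
  define p :: "'a poly" where "p = (\<Prod>c\<in>UNIV. [:- c, 1:]) + 1"
  have "Polynomial.degree (\<Prod>c\<in>(UNIV::'a set). [:- c, 1:]) = card (UNIV :: 'a set)"
    by (subst degree_prod_eq_sum_degree) simp_all
  moreover have "card (UNIV :: 'a set) > 0"
    using fin by (simp add: finite_UNIV_card_ge_0)
  ultimately have "Polynomial.degree p > 0"
    unfolding p_def by (subst degree_add_eq_left) simp_all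
  then obtain x where "poly p x = 0"
    using alg_closed_imp_poly_has_root by blast
  moreover have "poly (\<Prod>c\<in>UNIV. [:- c, 1:]) x = 0"
    using fin by (simp add: poly_prod)
  ultimately show False
    by (simp add: p_def)
qed

text \<open>Where y \<noteq> b the substitution can be inverted, so \<open>f\<close> vanishes at all
  these points, and the field is infinite.\<close>

lemma blowup_eq_0:
  fixes f :: "'a::alg_closed_field poly poly"
  assumes "blowup a b f = 0"
  shows "f = 0"
proof -
  have ev: "ev2 f x y = 0" if "y \<noteq> b" for x y
  proof -
    have "ev2 f x y = ev2 (blowup a b f) ((x - a) / (y - b)) (y - b)"
      using that by (simp add: ev2_blowup)
    then show ?thesis using assms by simp
  qed
  have inf: "infinite (UNIV - {b})"
    using infinite_alg_closed_field by simp
  have row: "poly f [:y:] = 0" if "y \<noteq> b" for y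
  proof (rule ccontr)
    assume "poly f [:y:] \<noteq> 0"
    then have "finite {x. poly (poly f [:y:]) x = 0}"
      by (rule poly_roots_finite)
    then show False
      using ev[OF that] infinite_alg_closed_field[where ?'a = 'a] by (simp add: ev2_def)
  qed
  show ?thesis
  proof (rule ccontr)
    assume "f \<noteq> 0"
    then have "finite {x. poly f x = 0}"
      by (rule poly_roots_finite)
    then have "finite ((\<lambda>y. [:y:]) ` (UNIV - {b}))"
      by (rule finite_subset[rotated]) (use row in auto)
    then show False
      using inf by (subst (asm) finite_image_iff) (auto simp: inj_on_def)
  qed
qed

text \<open>Only exponents divisible by the characteristic p survive, so \<open>f\<close> is a sum
  of p-th powers, and the p-th power map is additive.\<close>

lemma pderiv_0_imp_power:
  fixes f :: "'a::idom poly"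
  assumes p: "prime CHAR('a)" and "pderiv f = 0"
    and root: "\<And>i. \<exists>r. Polynomial.coeff f i = r ^ CHAR('a)"
  shows "\<exists>h. f = h ^ CHAR('a)"
proof -
  let ?p = "CHAR('a)"
  have "?p > 0" using p prime_gt_0_nat by blast
  obtain r where r: "\<And>i. Polynomial.coeff f i = r i ^ ?p"
    using root by metis
  have zero: "Polynomial.coeff f i = 0" if "\<not> ?p dvd i" for i
  proof -
    obtain k where k: "i = Suc k"
      using \<open>\<not> ?p dvd i\<close> by (cases i) auto
    have "of_nat i * Polynomial.coeff f i = 0"
      using assms(2) coeff_pderiv[of f k] k by simp
    moreover have "of_nat i \<noteq> (0::'a)"
      using that by (simp add: of_nat_eq_0_iff_char_dvd)
    ultimately show ?thesis by simp
  qed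
  define I where "I = {i. i \<le> Polynomial.degree f \<and> ?p dvd i}"
  have "f = (\<Sum>i\<le>Polynomial.degree f. Polynomial.monom (Polynomial.coeff f i) i)"
    by (simp add: poly_as_sum_of_monoms)
  also have "\<dots> = (\<Sum>i\<in>I. Polynomial.monom (Polynomial.coeff f i) i)"
    by (rule sum.mono_neutral_right) (auto simp: I_def zero)
  also have "\<dots> = (\<Sum>i\<in>I. Polynomial.monom (r i) (i div ?p) ^ ?p)"
    by (intro sum.cong) (auto simp: I_def monom_power r)
  also have "\<dots> = (\<Sum>i\<in>I. Polynomial.monom (r i) (i div ?p)) ^ ?p"
    by (rule freshmans_dream_sum[symmetric]) (use p in simp_all)
  finally show ?thesis by blast
qed

text \<open>The vanishing x-derivative makes the coefficients p-th powers, and the vanishing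
  y-derivative then makes \<open>f\<close> one. But a prime p-th power would divide its own p-th
  root, which has smaller degree.\<close>

lemma prime_elem_not_both_partials_0:
  fixes f :: "'a::alg_closed_field poly poly"
  assumes p: "prime CHAR('a)" and f: "prime_elem f" "dx f = 0" "dy f = 0"
  shows False
proof -
  let ?p = "CHAR('a)"
  have "?p > 1" using p prime_gt_1_nat by blast
  have "\<exists>h. f = h ^ CHAR('a poly)"
  proof (rule pderiv_0_imp_power)
    show "prime CHAR('a poly)" "pderiv f = 0"
      using p f by (simp_all add: dy_def)
  next
    fix j
    have "\<exists>h. Polynomial.coeff f j = h ^ CHAR('a)"
    proof (rule pderiv_0_imp_power[OF p])
      have "Polynomial.coeff (dx f) j = pderiv (Polynomial.coeff f j)"
        by (simp add: dx_def coeff_map_poly)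
      then show "pderiv (Polynomial.coeff f j) = 0"
        using f by simp
    next
      fix i
      obtain y where "y ^ ?p = cf f i j"
        using nth_root_exists[of ?p "cf f i j"] \<open>?p > 1\<close> by auto
      then show "\<exists>r. cf f i j = r ^ ?p" by metis
    qed
    then show "\<exists>r. Polynomial.coeff f j = r ^ CHAR('a poly)" by simp
  qed
  then obtain h where h: "f = h ^ ?p" by auto
  have "f dvd h"
    by (rule prime_elem_dvd_power[of f h ?p]) (use f(1) h in simp_all)
  then obtain k where k: "h = f * k" by blast
  have "f \<noteq> 0" using f(1) by auto
  then have "h \<noteq> 0" using h \<open>?p > 1\<close> by (auto simp: power_0_left split: if_splits)
  have "tdeg h = tdeg f + tdeg k"
    unfolding k by (rule tdeg_mult) (use k \<open>h \<noteq> 0\<close> \<open>f \<noteq> 0\<close> in auto)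
  then have "tdeg f \<le> tdeg h" by simp
  moreover have "tdeg f = ?p * tdeg h"
    using \<open>h \<noteq> 0\<close> by (subst h) (rule tdeg_power)
  moreover have "tdeg f > 0"
    by (rule tdeg_prime_pos[OF f(1)])
  moreover have "2 * tdeg h \<le> ?p * tdeg h"
    using \<open>?p > 1\<close> by (intro mult_le_mono1) simp
  ultimately show False by linarith
qed

text \<open>Over a domain lowest terms multiply, so the first nonzero coefficient sits at the sum of
  the orders. Only indices up to \<open>k\<close> enter, which suits products that are known just
  modulo a power of t.\<close>

lemma coeff_mult_lowest:
  fixes F Z :: "'a::idom poly"
  assumes "F \<noteq> 0" and low: "\<And>n. n < k \<Longrightarrow> Polynomial.coeff (F * Z) n = 0" and k: "Polynomial.coeff (F * Z) k \<noteq> 0"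
  shows "\<exists>\<mu>. k = Polynomial.order 0 F + \<mu> \<and> Polynomial.coeff (F * Z) k = Polynomial.coeff F (Polynomial.order 0 F) * Polynomial.coeff Z \<mu>"
proof -
  \<comment> \<open>Split off the exact power of the variable that divides the polynomial.\<close>
  have dec: "\<exists>G'. G = Polynomial.monom 1 (Polynomial.order 0 G) * G' \<and> Polynomial.coeff G' 0 \<noteq> 0" if G: "G \<noteq> 0" for G :: "'a poly"
  proof -
    obtain G' where "G = [:- 0, 1:] ^ Polynomial.order 0 G * G'" "\<not> [:- 0, 1:] dvd G'"
      using order_decomp[OF G] by blast
    then show ?thesis
      by (intro exI[of _ G']) (auto simp: Polynomial.monom_altdef dvd_iff_poly_eq_0 poly_eq_iff poly_0_coeff_0)
  qed
  have "Z \<noteq> 0" using k by auto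
  define \<nu> \<mu> where "\<nu> = Polynomial.order 0 F" and "\<mu> = Polynomial.order 0 Z"
  obtain F' where F': "F = Polynomial.monom 1 \<nu> * F'" "Polynomial.coeff F' 0 \<noteq> 0"
    using dec[OF \<open>F \<noteq> 0\<close>] unfolding \<nu>_def by blast
  obtain Z' where Z': "Z = Polynomial.monom 1 \<mu> * Z'" "Polynomial.coeff Z' 0 \<noteq> 0"
    using dec[OF \<open>Z \<noteq> 0\<close>] unfolding \<mu>_def by blast
  have FZ: "F * Z = Polynomial.monom 1 (\<nu> + \<mu>) * (F' * Z')"
  proof -
    have "Polynomial.monom 1 (\<nu> + \<mu>) = Polynomial.monom 1 \<nu> * (Polynomial.monom 1 \<mu> :: 'a poly)"
      by (simp add: Polynomial.mult_monom)
    then show ?thesis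
      by (simp add: F'(1) Z'(1) mult_ac)
  qed
  have c: "Polynomial.coeff (F * Z) (\<nu> + \<mu>) = Polynomial.coeff F \<nu> * Polynomial.coeff Z \<mu>"
    unfolding FZ by (simp add: F'(1) Z'(1) coeff_monom_mult coeff_mult_0)
  then have "Polynomial.coeff (F * Z) (\<nu> + \<mu>) \<noteq> 0"
    by (simp add: F' Z' coeff_monom_mult)
  then have "\<not> \<nu> + \<mu> < k" using low by blast
  moreover have "\<not> k < \<nu> + \<mu>"
    using k unfolding FZ by (auto simp: coeff_monom_mult)
  ultimately have "k = \<nu> + \<mu>" by simp
  with c show ?thesis
    unfolding \<nu>_def by auto
qed

text \<open>The variable u enters only through the product u t, so its exponent never exceeds that
  of t; the same holds for \<open>blowup\<close>.\<close>

lemma degree_coeff_blowup_x_le: "Polynomial.degree (Polynomial.coeff (blowup_x a p) n) \<le> n"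
proof (induction p arbitrary: n)
  case (pCons c p)
  show ?case
  proof (cases n)
    case 0
    have "Polynomial.degree (Polynomial.smult a (Polynomial.coeff (blowup_x a p) 0)) \<le> 0"
      using pCons.IH[of 0] degree_smult_le[of a] le_trans by blast
    then show ?thesis
      using 0 Polynomial.degree_add_le[of "[:c:]" 0 "Polynomial.smult a (Polynomial.coeff (blowup_x a p) 0)"]
      by (simp add: blowup_x_pCons coeff_mult_0)
  next
    case (Suc m)
    have "Polynomial.degree (pCons 0 (Polynomial.coeff (blowup_x a p) m)) \<le> Suc m"
      using pCons.IH[of m] degree_pCons_le le_trans Suc_le_mono by blast
    moreover have "Polynomial.degree (Polynomial.smult a (Polynomial.coeff (blowup_x a p) (Suc m))) \<le> Suc m"
      using pCons.IH[of "Suc m"] degree_smult_le[of a] le_trans by blast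
    ultimately show ?thesis using Suc
      by (simp add: blowup_x_pCons Polynomial.degree_add_le)
  qed
qed simp

lemma degree_coeff_blowup_le: "Polynomial.degree (Polynomial.coeff (blowup a b f) n) \<le> n"
proof (induction f arbitrary: n)
  case (pCons p f)
  have 1: "Polynomial.degree (Polynomial.smult b (Polynomial.coeff (blowup a b f) n)) \<le> n"
    using pCons.IH[of n] degree_smult_le[of b] le_trans by blast
  show ?case
  proof (cases n)
    case 0
    then show ?thesis
      using 1 degree_coeff_blowup_x_le[of a p 0]
        Polynomial.degree_add_le[of "Polynomial.coeff (blowup_x a p) 0" 0 "Polynomial.smult b (Polynomial.coeff (blowup a b f) 0)"]
      by (simp add: blowup_pCons coeff_mult_0)
  next
    case (Suc m)
    have "Polynomial.degree (Polynomial.coeff (blowup a b f) m) \<le> Suc m"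
      using pCons.IH[of m] by simp
    then show ?thesis using 1 degree_coeff_blowup_x_le[of a p n] Suc
      by (simp add: blowup_pCons Polynomial.degree_add_le)
  qed
qed simp

text \<open>The univariate identity records at once that c is fixed by the q-th power and that this
  power is additive on the difference; substituting \<open>x\<close> for the variable carries it
  over.\<close>

lemma frobenius_linear:
  fixes c :: "'a::field" and x :: "'a poly poly"
  assumes "[:- c, 1:] ^ q = Polynomial.monom 1 q - [:c:]"
  shows "(x - [:[:c:]:]) ^ q = x ^ q - [:[:c:]:]"
proof -
  define \<phi> where "\<phi> = (\<lambda>p. poly (map_poly (\<lambda>c::'a. [:[:c:]:]) p) x)"
  have \<phi>: "\<phi> (p + r) = \<phi> p + \<phi> r" "\<phi> (p * r) = \<phi> p * \<phi> r" for p r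
    unfolding \<phi>_def by (simp_all add: poly_map_poly_add poly_map_poly_mult)
  have pow: "\<phi> (p ^ n) = \<phi> p ^ n" for p n
    by (induction n) (simp_all add: \<phi>, simp add: \<phi>_def map_poly_pCons one_pCons)
  have "\<phi> ([:- c, 1:] ^ q + [:c:]) = \<phi> ([:0, 1:] ^ q)"
    using assms by (simp add: Polynomial.monom_altdef)
  then have "\<phi> [:- c, 1:] ^ q + \<phi> [:c:] = \<phi> [:0, 1:] ^ q"
    by (simp only: \<phi> pow)
  moreover have "\<phi> [:- c, 1:] = x - [:[:c:]:]" "\<phi> [:c:] = [:[:c:]:]" "\<phi> [:0, 1:] = x"
    by (simp_all add: \<phi>_def map_poly_pCons flip: one_pCons)
  ultimately show ?thesis
    by (simp add: eq_diff_eq)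
qed

text \<open>The derivative in the direction of the homogenising variable is eliminated by Euler's
  identity.\<close>

definition polar :: "'a::idom \<Rightarrow> 'a \<Rightarrow> 'a poly poly \<Rightarrow> 'a poly poly" where
  "polar a b f = of_nat (tdeg f) * f - ((vx - [:[:a:]:]) * dx f + (vy - [:[:b:]:]) * dy f)"

lemma cf_vx_mult: "cf (vx * f) i j = (case i of 0 \<Rightarrow> 0 | Suc i \<Rightarrow> cf f i j)"
  by (simp add: vx_def Polynomial.coeff_pCons)

lemma cf_vy_mult: "cf (vy * f) i j = (case j of 0 \<Rightarrow> 0 | Suc j \<Rightarrow> cf f i j)"
  by (simp add: vy_def Polynomial.coeff_pCons split: nat.split)

text \<open>For the polar of the origin, called \<open>h\<close> below, the coefficient at x^i y^j
  is multiplied by \<open>tdeg f\<close> - i - j, which is 0 in top degree. Moving the point to (a,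
  b) only adds multiples of first derivatives.\<close>

lemma tdeg_polar_le:
  assumes "0 < tdeg f"
  shows "tdeg (polar a b f) \<le> tdeg f - 1"
proof -
  define h where "h = of_nat (tdeg f) * f - (vx * dx f + vy * dy f)"
  have "polar a b f = h + ([:[:a:]:] * dx f + [:[:b:]:] * dy f)"
    by (simp add: polar_def h_def algebra_simps)
  moreover have "tdeg h \<le> tdeg f - 1"
    unfolding tdeg_le_iff
  proof (intro allI impI)
    fix i j assume "tdeg f - 1 < i + j"
    then consider "tdeg f < i + j" | "tdeg f = i + j" using assms by linarith
    moreover have "cf h i j = of_nat (tdeg f) * cf f i j - (of_nat i * cf f i j + of_nat j * cf f i j)"
      by (auto simp: h_def cf_vx_mult cf_vy_mult cf_dx cf_dy of_nat_poly split: nat.splits)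
    ultimately show "cf h i j = 0"
    proof cases
      case 1
      then have "cf f i j = 0" using tdeg_le_iff[of f "tdeg f"] by auto
      with \<open>cf h i j = _\<close> show ?thesis by simp
    next
      case 2
      with \<open>cf h i j = _\<close> show ?thesis by (simp add: algebra_simps)
    qed
  qed
  moreover have "tdeg ([:[:a:]:] * dx f + [:[:b:]:] * dy f) \<le> 0 + (tdeg f - 1)"
    by (intro tdeg_add_le tdeg_mult_le' tdeg_dx tdeg_dy) simp_all
  ultimately show ?thesis
    by (simp add: tdeg_add_le)
qed

text \<open>Tangents through both points would all equal the joining line \<open>l\<close>.
  Algebraically, two vanishing polars make \<open>f\<close> divide \<open>l\<close> times each
  partial derivative; having degree at least 2, \<open>f\<close> does not divide \<open>l\<close>,
  so it divides the partial derivatives, which are then 0 for degree reasons.\<close>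

lemma not_all_points_strange:
  fixes f :: "'a::alg_closed_field poly poly"
  assumes p: "prime CHAR('a)" and f: "prime_elem f" "2 \<le> tdeg f" and ne: "(a, b) \<noteq> (a', b')"
  shows "\<not> f dvd polar a b f \<or> \<not> f dvd polar a' b' f"
proof (rule ccontr)
  assume "\<not> ?thesis"
  moreover have "tdeg (polar a b f) < tdeg f" "tdeg (polar a' b' f) < tdeg f"
    using tdeg_polar_le[of f a b] tdeg_polar_le[of f a' b'] f(2) by linarith+
  ultimately have 0: "polar a b f = 0" "polar a' b' f = 0"
    using tdeg_dvd_less by blast+
  define A B :: "'a poly poly" where "A = [:[:a - a':]:]" and "B = [:[:b - b':]:]"
  define l where "l = A * (vy - [:[:b:]:]) - B * (vx - [:[:a:]:])"
  have "[:[:a:]:] = A + [:[:a':]:]" "[:[:b:]:] = B + [:[:b':]:]"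
    by (simp_all add: A_def B_def)
  \<comment> \<open>The difference of the polars is the derivative in the direction joining the two
    points.\<close>
  then have "polar a b f - polar a' b' f = A * dx f + B * dy f"
    by (simp add: polar_def algebra_simps del: mult_pCons_left mult_pCons_right diff_pCons)
  then have AB: "A * dx f + B * dy f = 0"
    using 0 by simp
  have e: "of_nat (tdeg f) * f = (vx - [:[:a:]:]) * dx f + (vy - [:[:b:]:]) * dy f"
    using 0(1) by (simp add: polar_def)
  have "(A * of_nat (tdeg f)) * f = A * (of_nat (tdeg f) * f)"
    by (simp add: mult_ac)
  also have "\<dots> = (vx - [:[:a:]:]) * (A * dx f) + A * (vy - [:[:b:]:]) * dy f"
    unfolding e by (simp add: algebra_simps)
  also have "A * dx f = - (B * dy f)"
    using AB by (simp add: eq_neg_iff_add_eq_0)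
  also have "(vx - [:[:a:]:]) * (- (B * dy f)) + A * (vy - [:[:b:]:]) * dy f = dy f * l"
    by (simp add: l_def algebra_simps)
  finally have 1: "f dvd dy f * l"
    by (metis dvd_triv_right)
  have "(B * of_nat (tdeg f)) * f = B * (of_nat (tdeg f) * f)"
    by (simp add: mult_ac)
  also have "\<dots> = B * (vx - [:[:a:]:]) * dx f + (vy - [:[:b:]:]) * (B * dy f)"
    unfolding e by (simp add: algebra_simps)
  also have "B * dy f = - (A * dx f)"
    using AB by (metis add.commute eq_neg_iff_add_eq_0)
  also have "B * (vx - [:[:a:]:]) * dx f + (vy - [:[:b:]:]) * - (A * dx f) = dx f * - l"
    by (simp add: l_def algebra_simps)
  finally have 2: "f dvd dx f * l"
    by (metis dvd_triv_right dvd_minus_iff mult_minus_right)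
  have "l \<noteq> 0"
  proof
    assume "l = 0"
    then have "dx l = 0" "dy l = 0" by simp_all
    then have "A = 0" "B = 0" by (simp_all add: l_def A_def B_def)
    then show False using ne by (simp add: A_def B_def)
  qed
  moreover have "tdeg l \<le> 0 + 1"
    unfolding l_def A_def B_def by (intro tdeg_diff_le tdeg_mult_le') simp_all
  ultimately have "\<not> f dvd l"
    using tdeg_dvd_less[of f l] f(2) by auto
  then have "f dvd dx f" "f dvd dy f"
    using 1 2 f(1) prime_elem_dvd_mult_iff by blast+
  then have "dx f = 0" "dy f = 0"
    using tdeg_dx[of f] tdeg_dy[of f] f(2) by (intro tdeg_dvd_less[of f]; linarith)+
  then show False
    using prime_elem_not_both_partials_0[OF p f(1)] by blast
qed

text \<open>Modulo \<open>f\<close> the polar of the rational point \<open>P = (a, b)\<close> agrees with the polar of the Frobenius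
  image of the moving point, hence lies in the \<open>q\<close>-th power of the maximal ideal at \<open>P\<close>.\<close>

lemma polar_high_contact:
  fixes f :: "'a::alg_closed_field poly poly"
  assumes f: "prime_elem f" "ev2 f a b = 0" and nc: "f dvd frob_tangent q f"
    and ndvd: "\<not> f dvd polar a b f"
    and frob: "[:- a, 1:] ^ q = Polynomial.monom 1 q - [:a:]" "[:- b, 1:] ^ q = Polynomial.monom 1 q - [:b:]"
  shows "q \<le> tdeg f * tdeg (polar a b f)"
proof -
  define F where "F = blowup a b f"
  define \<nu> where "\<nu> = Polynomial.order 0 F"
  have "f \<noteq> 0" using f(1) by auto
  then have "F \<noteq> 0" unfolding F_def using blowup_eq_0 by blast
  \<comment> \<open>No power of the initial form of \<open>s\<close> may be divisible by the lowest
    form of \<open>f\<close> at the point, which is the coefficient of index \<open>\<nu>\<close>.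
    If that form is constant in u, it is a multiple of a power of y - b, and x - a serves; otherwise
    it involves x - a, and y - b serves.\<close>
  define s where "s = (if Polynomial.degree (Polynomial.coeff F \<nu>) = 0 then vx - [:[:a:]:] else vy - [:[:b:]:])"
  obtain w where w: "frob_tangent q f = f * w" using nc by blast
  define W where "W = of_nat (tdeg f) + w"
  have "polar a b f = f * (of_nat (tdeg f) + w) - ((vx - [:[:a:]:]) ^ q * dx f + (vy - [:[:b:]:]) ^ q * dy f)"
    using w unfolding frobenius_linear[OF frob(1)] frobenius_linear[OF frob(2)]
    by (simp add: polar_def frob_tangent_def algebra_simps)
  then have eqP: "polar a b f = f * W - ((vx - [:[:a:]:]) ^ q * dx f + (vy - [:[:b:]:]) ^ q * dy f)"
    by (simp add: W_def)
  have bx: "blowup a b (vx - [:[:a:]:]) = Polynomial.monom [:0, 1:] 1"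
    by (simp add: vx_def blowup_pCons blowup_x_pCons Polynomial.monom_altdef)
  have bvy: "blowup a b (vy - [:[:b:]:]) = Polynomial.monom 1 1"
    by (simp add: vy_def blowup_pCons blowup_x_pCons Polynomial.monom_altdef one_pCons)
  define R where "R = - ([:[:0, 1:]:] ^ q * blowup a b (dx f) + blowup a b (dy f))"
  have mq: "Polynomial.monom [:0, 1:] 1 ^ q = Polynomial.monom 1 q * [:[:0, 1:] :: 'a poly:] ^ q"
    by (simp add: monom_power poly_const_pow Polynomial.smult_monom)
  have mq': "Polynomial.monom 1 1 ^ q = (Polynomial.monom 1 q :: 'a poly poly)"
    by (simp add: monom_power)
  \<comment> \<open>Modulo t^q the polar becomes a multiple of \<open>F\<close>, and so does every
    element of the ideal.\<close>
  have pol: "blowup a b (polar a b f) = F * blowup a b W + Polynomial.monom 1 q * R"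
    unfolding eqP blowup_diff[of a b "f * W"] blowup_simps blowup_power bx bvy mq mq' F_def R_def
    by (simp add: algebra_simps)
  have \<nu>_pos: "0 < \<nu>"
  proof -
    have "Polynomial.degree (Polynomial.coeff F 0) = 0"
      using degree_coeff_blowup_le[of a b f 0] by (simp add: F_def)
    moreover have "poly (Polynomial.coeff F 0) 0 = 0"
      using ev2_blowup[of a b f 0 0] f(2) by (simp add: F_def ev2_def poly_0_coeff_0)
    ultimately have "Polynomial.coeff F 0 = 0"
      by (metis degree_eq_zeroE mult_zero_left add.right_neutral pCons_0_0 poly_pCons)
    then have "poly F 0 = 0" by (simp add: poly_0_coeff_0)
    then show ?thesis
      using \<open>F \<noteq> 0\<close> order_root[of F 0] by (simp add: \<nu>_def)
  qed
  have "card {..<q} \<le> tdeg f * tdeg (polar a b f)"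
  proof (rule bezout_dim[OF f(1) ndvd, where s = "\<lambda>k. s ^ k"])
    fix c :: "nat \<Rightarrow> 'a" and A B
    assume eq: "(\<Sum>k<q. Polynomial.smult [:c k:] (s ^ k)) = A * f + B * polar a b f"
    define \<sigma> :: "nat \<Rightarrow> 'a poly" where
      "\<sigma> = (\<lambda>k. if Polynomial.degree (Polynomial.coeff F \<nu>) = 0 then Polynomial.monom (c k) k else [:c k:])"
    have s: "blowup a b (Polynomial.smult [:c k:] (s ^ k)) = Polynomial.monom (\<sigma> k) k" for k
    proof -
      have "Polynomial.monom (1::'a) 1 = [:0, 1:]"
        by (simp add: Polynomial.monom_altdef)
      with bx have "blowup a b (vx - [:[:a:]:]) = Polynomial.monom (Polynomial.monom 1 1) 1"
        by simp
      with bvy show ?thesis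
        by (simp add: s_def \<sigma>_def monom_power Polynomial.smult_monom del: blowup_diff)
    qed
    define Z where "Z = blowup a b (A + B * W)"
    have "(\<Sum>k<q. Polynomial.monom (\<sigma> k) k) = blowup a b (A * f + B * polar a b f)"
      by (simp only: s[symmetric] blowup_sum[symmetric] eq)
    also have "\<dots> = F * Z + Polynomial.monom 1 q * (blowup a b B * R)"
      by (simp add: pol F_def[symmetric] Z_def algebra_simps)
    finally have "(\<Sum>k<q. Polynomial.monom (\<sigma> k) k) = F * Z + Polynomial.monom 1 q * (blowup a b B * R)" .
    then have "Polynomial.coeff (\<Sum>k<q. Polynomial.monom (\<sigma> k) k) n = Polynomial.coeff (F * Z) n" if "n < q" for n
      using that by (simp add: coeff_monom_mult)
    moreover have "Polynomial.coeff (\<Sum>k<q. Polynomial.monom (\<sigma> k) k) n = \<sigma> n" if "n < q" for n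
      using that by (simp add: Polynomial.coeff_sum sum.delta)
    ultimately have FZ: "Polynomial.coeff (F * Z) n = \<sigma> n" if "n < q" for n
      using that by simp
    have \<sigma>0: "\<sigma> k = 0 \<longleftrightarrow> c k = 0" for k
      by (simp add: \<sigma>_def)
    show "\<forall>k\<in>{..<q}. c k = 0"
    proof (rule ccontr)
      assume "\<not> (\<forall>k\<in>{..<q}. c k = 0)"
      then have ex: "\<exists>k. k < q \<and> c k \<noteq> 0" by auto
      define k where "k = (LEAST k. k < q \<and> c k \<noteq> 0)"
      have k: "k < q" "c k \<noteq> 0" using LeastI_ex[OF ex] by (simp_all add: k_def)
      have low: "c n = 0" if "n < k" for n
        using not_less_Least[of n "\<lambda>k. k < q \<and> c k \<noteq> 0"] that k(1) unfolding k_def by auto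
      obtain \<mu> where \<mu>: "k = \<nu> + \<mu>" "\<sigma> k = Polynomial.coeff F \<nu> * Polynomial.coeff Z \<mu>"
        using coeff_mult_lowest[OF \<open>F \<noteq> 0\<close>, of k Z] FZ low \<sigma>0 k unfolding \<nu>_def
        by (metis dual_order.strict_trans)
      have "\<sigma> k \<noteq> 0" using k \<sigma>0 by simp
      then have deg: "Polynomial.degree (\<sigma> k) = Polynomial.degree (Polynomial.coeff F \<nu>) + Polynomial.degree (Polynomial.coeff Z \<mu>)"
        using \<mu>(2) by (simp add: Polynomial.degree_mult_eq)
      \<comment> \<open>Compare degrees in u. For x - a the product has degree at most
        \<open>\<mu>\<close>, which is less than k because \<open>\<nu>\<close> is positive; for y -
        b the product has positive degree, but \<open>\<sigma> k\<close> has degree 0.\<close>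
      show False
      proof (cases "Polynomial.degree (Polynomial.coeff F \<nu>) = 0")
        case True
        have "Polynomial.degree (\<sigma> k) = k"
          using True k by (simp add: \<sigma>_def Polynomial.degree_monom_eq)
        moreover have "Polynomial.degree (Polynomial.coeff Z \<mu>) \<le> \<mu>"
          unfolding Z_def by (rule degree_coeff_blowup_le)
        ultimately show False
          using deg True \<mu>(1) \<nu>_pos by linarith
      next
        case False
        then have "Polynomial.degree (\<sigma> k) = 0" by (simp add: \<sigma>_def)
        with deg False show False by simp
      qed
    qed
  qed simp
  then show ?thesis by simp
qed

section \<open>Rational points on an arbitrary curve\<close>

lemma card_rational_points_component:
  fixes f :: "'a::alg_closed_field poly poly"
  assumes char: "prime CHAR('a)" "0 < q" "of_nat q = (0::'a)"
    and f: "prime_elem f" "2 \<le> tdeg f" and q: "tdeg f * (tdeg f - 1) < q" and "finite N"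
    and N: "\<And>a b. (a, b) \<in> N \<Longrightarrow> ev2 f a b = 0"
    and frob: "\<And>a b. (a, b) \<in> N \<Longrightarrow> [:- a, 1:] ^ q = Polynomial.monom 1 q - [:a:]"
      "\<And>a b. (a, b) \<in> N \<Longrightarrow> [:- b, 1:] ^ q = Polynomial.monom 1 q - [:b:]"
  shows "2 * card N \<le> tdeg f * (tdeg f + q - 1)"
proof (cases "f dvd frob_tangent q f")
  case False
  have fixq: "c ^ q = c" if "[:- c, 1:] ^ q = Polynomial.monom 1 q - [:c:]" for c :: 'a
    using arg_cong[OF that, of "\<lambda>p. poly p c"] char(2) by (simp add: poly_monom power_0_left)
  show ?thesis
    by (rule card_rational_points_classical[OF f(1) char(2,3) \<open>finite N\<close> _ False])
       (use N fixq frob in blast)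
next
  case True
  have "card N \<le> 1"
  proof (rule ccontr)
    assume "\<not> card N \<le> 1"
    then obtain P R where "P \<in> N" "R \<in> N" "P \<noteq> R"
      using \<open>finite N\<close> card_le_Suc0_iff_eq by (metis One_nat_def)
    \<comment> \<open>At most one of the two points can have its polar divisible by
      \<open>f\<close>; the other one has high contact.\<close>
    then obtain a b where ab: "(a, b) \<in> N" "\<not> f dvd polar a b f"
      using not_all_points_strange[OF char(1) f, of "fst P" "snd P" "fst R" "snd R"] by (metis prod.collapse)
    then have "q \<le> tdeg f * tdeg (polar a b f)"
      using N frob by (intro polar_high_contact[OF f(1) _ True]) blast+
    also have "\<dots> \<le> tdeg f * (tdeg f - 1)"
      using f(2) by (intro mult_le_mono2 tdeg_polar_le) simp
    finally show False using q by simp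
  qed
  then have "2 * card N \<le> 2 * 1" by simp
  also have "\<dots> \<le> tdeg f * (tdeg f + q - 1)"
    using f(2) by (intro mult_le_mono) auto
  finally show ?thesis .
qed

text \<open>The factor d + q - 1 stays fixed along the induction over prime factors, so the bound is
  additive in the degree; the hypothesis on lines puts factors of degree 1 under the same
  bound.\<close>

lemma card_rational_points_curve:
  fixes f :: "'a::{field_gcd, alg_closed_field} poly poly"
  assumes char: "prime CHAR('a)" "0 < q" "of_nat q = (0::'a)" and "finite N"
    and frob: "\<And>a b. (a, b) \<in> N \<Longrightarrow> [:- a, 1:] ^ q = Polynomial.monom 1 q - [:a:]"
      "\<And>a b. (a, b) \<in> N \<Longrightarrow> [:- b, 1:] ^ q = Polynomial.monom 1 q - [:b:]"
    and lines: "\<And>l. tdeg l = 1 \<Longrightarrow> 2 * card {(a, b) \<in> N. ev2 l a b = 0} \<le> d + q - 1"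
    and q: "d * (d - 1) < q"
    and f: "f \<noteq> 0" "tdeg f \<le> d"
  shows "2 * card {(a, b) \<in> N. ev2 f a b = 0} \<le> tdeg f * (d + q - 1)"
  using f
proof (induction f rule: prime_divisors_induct)
  case zero
  then show ?case by simp
next
  case (unit x)
  then obtain y where "1 = x * y" by blast
  then have "ev2 x a b * ev2 y a b = 1" for a b
    by (metis ev2_simps(2,4))
  then have *: "{(a, b) \<in> N. ev2 x a b = 0} = {}"
    by (auto, metis mult_zero_left zero_neq_one)
  show ?case unfolding * by simp
next
  case (factor p x)
  have p: "prime_elem p" using factor.hyps by (rule prime_imp_prime_elem)
  have "x \<noteq> 0" "p \<noteq> 0" using factor.prems by auto
  then have deg: "tdeg (p * x) = tdeg p + tdeg x" by (simp add: tdeg_mult)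
  let ?N = "\<lambda>f. {(a, b) \<in> N. ev2 f a b = 0}"
  have fin: "finite (?N f)" for f
    using \<open>finite N\<close> by (rule finite_subset[rotated]) auto
  have "2 * card (?N p) \<le> tdeg p * (d + q - 1)"
  proof (cases "tdeg p = 1")
    case True
    then show ?thesis using lines[of p] by simp
  next
    case False
    then have e: "2 \<le> tdeg p" using tdeg_prime_pos[OF p] by linarith
    have le: "tdeg p \<le> d" using deg factor.prems by simp
    have "tdeg p * (tdeg p - 1) \<le> d * (d - 1)"
      using le by (intro mult_le_mono) auto
    then have "2 * card (?N p) \<le> tdeg p * (tdeg p + q - 1)"
      using q fin frob by (intro card_rational_points_component[OF char p e]) auto
    also have "\<dots> \<le> tdeg p * (d + q - 1)"
      using le by (intro mult_le_mono2) auto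
    finally show ?thesis .
  qed
  moreover have "2 * card (?N x) \<le> tdeg x * (d + q - 1)"
    using factor.IH \<open>x \<noteq> 0\<close> deg factor.prems by simp
  moreover have "card (?N (p * x)) \<le> card (?N p) + card (?N x)"
    by (rule le_trans[OF card_mono card_Un_le]) (use fin in auto)
  ultimately show ?case
    by (simp add: deg add_mult_distrib)
qed

section \<open>The algebraic closure of a finite field: unique factorisation and the q-th power
  map\<close>

instance alg_closure :: (field) field_gcd ..

lemma prime_CHAR_finite_field: "prime CHAR('k::{field, finite})"
proof -
  have "CHAR('k) > 0"
    by (rule finite_imp_CHAR_pos) simp
  then show ?thesis by (rule prime_CHAR_semidom)
qed

text \<open>The leading terms of the two sides cancel, so their difference has degree below q; it
  vanishes on all q elements of the finite field and is therefore 0.\<close>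

lemma frobenius_to_ac:
  fixes c :: "'k::{field, finite}"
  shows "[:- to_ac c, 1:] ^ CARD('k) = Polynomial.monom 1 CARD('k) - [:to_ac c:]"
proof -
  let ?q = "CARD('k)"
  have q: "?q > 0" by simp
  have fixq: "x ^ ?q = x" for x :: 'k
  proof (cases "x = 0")
    case False
    have "(\<Prod>y\<in>UNIV-{0::'k}. y) = (\<Prod>y\<in>UNIV-{0}. x * y)"
      by (rule prod.reindex_bij_witness[of _ "\<lambda>y. x * y" "\<lambda>y. y / x"]) (use False in auto)
    also have "\<dots> = x ^ (?q - 1) * (\<Prod>y\<in>UNIV-{0}. y)"
      by (simp add: prod.distrib)
    finally have "x ^ (?q - 1) = 1" by simp
    then have "x * x ^ (?q - 1) = x" by simp
    then show ?thesis using q by (simp flip: power_Suc)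
  qed (use q in \<open>simp add: power_0_left\<close>)
  define D where "D = [:- to_ac c, 1:] ^ ?q - Polynomial.monom 1 ?q + [:to_ac c:]"
  have "D = 0"
  proof (rule ccontr)
    assume "D \<noteq> 0"
    have "poly D (to_ac x) = 0" for x
    proof -
      have "poly D (to_ac x) = to_ac ((x - c) ^ ?q - x ^ ?q + c)"
        by (simp add: D_def poly_monom)
      then show ?thesis
        by (simp only: fixq) simp
    qed
    then have "range to_ac \<subseteq> {x. poly D x = 0}"
      by auto
    then have "card (range (to_ac :: 'k \<Rightarrow> _)) \<le> card {x. poly D x = 0}"
      using poly_roots_finite[OF \<open>D \<noteq> 0\<close>] by (rule card_mono[rotated])
    also have "\<dots> \<le> Polynomial.degree D"
      using \<open>D \<noteq> 0\<close> by (rule card_poly_roots_bound)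
    also have "\<dots> < ?q"
    proof -
      have "Polynomial.degree D \<le> ?q"
        unfolding D_def
        by (intro Polynomial.degree_add_le Polynomial.degree_diff_le)
           (simp_all add: degree_linear_power Polynomial.degree_monom_le)
      moreover have "Polynomial.coeff D ?q = 0"
      proof -
        have "Polynomial.coeff [:to_ac c:] ?q = 0"
          using q by (intro coeff_eq_0) (simp del: zero_less_card_finite)
        then show ?thesis
          by (simp only: D_def Polynomial.coeff_add Polynomial.coeff_diff coeff_linear_power Polynomial.coeff_monom) simp
      qed
      ultimately show ?thesis
        using \<open>D \<noteq> 0\<close> by (metis leading_coeff_0_iff le_neq_implies_less)
    qed
    finally show False
      using card_image[OF inj_to_ac[where ?'a = 'k]] by simp
  qed
  then show ?thesis
    by (simp add: D_def algebra_simps eq_diff_eq)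
qed

section \<open>Secants in the projective plane\<close>

text \<open>Extend a basis of \<open>U\<close> to one of the whole space and keep two vectors,
  including the old ones. Dimensions 0 and 1 are covered as well, since an irrational line cuts out
  such subspaces.\<close>

lemma subspace_subset_line:
  fixes U :: "('k::field ^ 3) set"
  assumes U: "vec.subspace U" "U \<noteq> UNIV"
  shows "\<exists>l\<in>pg2_lines. \<forall>P\<in>pg2_points. P \<subseteq> U \<longrightarrow> P \<in> l"
proof -
  obtain B where B: "B \<subseteq> U" "vec.independent B" "U \<subseteq> vec.span B"
    using vec.basis_exists[of U] by metis
  have UB: "U = vec.span B"
    using B U(1) by (simp add: subset_antisym vec.span_minimal)
  define E where "E = vec.extend_basis B"
  have E: "B \<subseteq> E" "vec.independent E" "vec.span E = UNIV"
    using B(2) by (simp_all add: E_def vec.extend_basis_superset vec.independent_extend_basis)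
  have finE: "finite E" using E(2) by (rule vec.finiteI_independent)
  have "card E = vec.dim (UNIV :: ('k ^ 3) set)"
    using vec.dim_span_eq_card_independent[OF E(2)] E(3) by simp
  then have cardE: "card E = 3"
    by (simp add: card_cart_basis)
  have "B \<noteq> E" using UB E(3) U(2) by auto
  then have "card B < card E"
    using E(1) finE by (intro psubset_card_mono) auto
  then have "card B \<le> 2" using cardE by simp
  then obtain C where C: "B \<subseteq> C" "C \<subseteq> E" "card C = 2"
    using exists_subset_between[of B 2 E] E(1) finE cardE by auto
  have "vec.independent C"
    using E(2) C(2) by (rule vec.independent_mono)
  then have "vec.dim (vec.span C) = 2"
    using C(3) by (simp add: vec.dim_span_eq_card_independent del: vec.dim_span)
  then have "{P \<in> pg2_points. P \<subseteq> vec.span C} \<in> pg2_lines"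
    unfolding pg2_lines_def by (intro CollectI exI[of _ "vec.span C"]) simp
  moreover have "U \<subseteq> vec.span C"
    unfolding UB using C(1) by (rule vec.span_mono)
  then have "\<forall>P\<in>pg2_points. P \<subseteq> U \<longrightarrow> P \<in> {P \<in> pg2_points. P \<subseteq> vec.span C}"
    by auto
  ultimately show ?thesis by (rule bexI[rotated])
qed

lemma card_le_max_secant:
  fixes K :: "('k::{field, finite} ^ 3) set set"
  assumes "l \<in> pg2_lines"
  shows "card (l \<inter> K) \<le> max_secant K"
proof (cases "l \<inter> K = {}")
  case False
  then show ?thesis
    unfolding max_secant_def using assms by (intro Max_ge) (auto simp: lines_meeting_def)
qed simp

lemma min_secant_le_card:
  fixes K :: "('k::{field, finite} ^ 3) set set"
  assumes "l \<in> pg2_lines" "l \<inter> K \<noteq> {}"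
  shows "min_secant K \<le> card (l \<inter> K)"
  unfolding min_secant_def using assms by (intro Min_le) (auto simp: lines_meeting_def)

lemma card_in_subspace_le_max_secant:
  fixes K :: "('k::{field, finite} ^ 3) set set"
  assumes "K \<subseteq> pg2_points" "vec.subspace U" "U \<noteq> UNIV"
  shows "card {P \<in> K. P \<subseteq> U} \<le> max_secant K"
proof -
  obtain l where l: "l \<in> pg2_lines" "\<forall>P\<in>pg2_points. P \<subseteq> U \<longrightarrow> P \<in> l"
    using subspace_subset_line[OF assms(2,3)] by (rule bexE)
  have "card {P \<in> K. P \<subseteq> U} \<le> card (l \<inter> K)"
    by (rule card_mono) (use l(2) assms(1) in auto)
  then show ?thesis using card_le_max_secant[OF l(1), of K] by simp
qed

lemma pg2_point_eq_span:
  assumes "P \<in> pg2_points" "v \<in> P" "v \<noteq> 0"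
  shows "P = vec.span {v}"
proof -
  have P: "vec.subspace P" "vec.dim P = 1" using assms(1) by (auto simp: pg2_points_def)
  have ind: "vec.independent {v}" using assms(3) by simp
  have "P \<subseteq> vec.span {v}"
    using vec.card_ge_dim_independent[of "{v}" P] assms(2) ind P by simp
  moreover have "vec.span {v} \<subseteq> P"
    using P(1) assms(2) by (intro vec.span_minimal) auto
  ultimately show ?thesis by blast
qed

lemma pg2_point_obtain:
  assumes "P \<in> pg2_points"
  obtains v where "v \<in> P" "v \<noteq> 0" "P = vec.span {v}"
proof -
  have "\<not> P \<subseteq> {0}"
  proof
    assume "P \<subseteq> {0}"
    then have "vec.dim P = 0" by simp
    with assms show False by (simp add: pg2_points_def)
  qed
  then show thesis using that pg2_point_eq_span[OF assms] by blast
qed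

lemma span_pair_iff: "w \<in> vec.span {p, d} \<longleftrightarrow> (\<exists>a c. w = a *s p + c *s d)"
proof -
  have "w \<in> vec.span {p, d} \<longleftrightarrow> (\<exists>a c. w - a *s p = c *s d)"
    by (auto simp: vec.span_insert vec.span_singleton)
  then show ?thesis by (simp add: diff_eq_eq add.commute)
qed

text \<open>The q + 1 lines through a point partition the remaining points. The index type lists
  their directions as q slopes and one vertical direction.\<close>

lemma card_eq_sum_over_pencil:
  fixes K :: "('k::{field, finite} ^ 3) set set"
  assumes K: "K \<subseteq> pg2_points" "P\<^sub>0 \<in> K"
  shows "\<exists>line :: 'k option \<Rightarrow> _. (\<forall>e. line e \<in> pg2_lines \<and> P\<^sub>0 \<in> line e)
    \<and> card K = 1 + (\<Sum>e\<in>UNIV. card (line e \<inter> K) - 1)"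
proof -
  have P0: "P\<^sub>0 \<in> pg2_points" using K by blast
  obtain p where p: "p \<in> P\<^sub>0" "p \<noteq> 0" "P\<^sub>0 = vec.span {p}"
    using pg2_point_obtain[OF P0] .
  obtain i where i: "p $ i \<noteq> 0" using p(2) by (auto simp: vec_eq_iff)
  obtain j k where jk: "i \<noteq> j" "i \<noteq> k" "j \<noteq> k" "UNIV = {i, j, k}"
  proof -
    consider "i = 1" | "i = 2" | "i = 3" using exhaust_3 by blast
    then have "\<exists>j k. i \<noteq> j \<and> i \<noteq> k \<and> j \<noteq> k \<and> UNIV = {i, j, k}"
    proof cases
      case 1
      then show ?thesis using UNIV_3 by (intro exI[of _ 2] exI[of _ 3]) simp
    next
      case 2
      then show ?thesis using UNIV_3 by (intro exI[of _ 1] exI[of _ 3]) (simp add: insert_commute)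
    next
      case 3
      then show ?thesis using UNIV_3 by (intro exI[of _ 1] exI[of _ 2]) (simp add: insert_commute)
    qed
    then show thesis using that by blast
  qed
  have eqI: "v = w" if "v $ i = w $ i" "v $ j = w $ j" "v $ k = w $ k" for v w :: "'k ^ 3"
  proof -
    have "v $ x = w $ x" for x
      using that jk(4) by (metis UNIV_I insertE singletonD)
    then show ?thesis by (simp add: vec_eq_iff)
  qed
  \<comment> \<open>Representatives of the points of the line on which coordinate \<open>i\<close>
    is 0; this line misses \<open>P\<^sub>0\<close>.\<close>
  define dir :: "'k option \<Rightarrow> 'k ^ 3" where
    "dir = (\<lambda>e. case e of None \<Rightarrow> axis k 1 | Some s \<Rightarrow> axis j 1 + s *s axis k 1)"
  have dir_i: "dir e $ i = 0" for e
    using jk by (auto simp: dir_def axis_def split: option.splits)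
  have dir_j: "dir e $ j = (case e of None \<Rightarrow> 0 | Some s \<Rightarrow> 1)" for e
    using jk by (auto simp: dir_def axis_def split: option.splits)
  have dir_k: "dir e $ k = (case e of None \<Rightarrow> 1 | Some s \<Rightarrow> s)" for e
    using jk by (auto simp: dir_def axis_def split: option.splits)
  have dir_inj: "c = 0" if "c *s dir e = c' *s dir e'" "e \<noteq> e'" for c c' e e'
  proof -
    have "c * dir e $ j = c' * dir e' $ j" "c * dir e $ k = c' * dir e' $ k"
      using that(1) by (metis vector_smult_component)+
    then show ?thesis
      using that(2) by (auto simp: dir_j dir_k split: option.splits)
  qed
  define W where "W = (\<lambda>e. vec.span {p, dir e})"
  define line where "line = (\<lambda>e. {P \<in> pg2_points. P \<subseteq> W e})"
  have line: "line e \<in> pg2_lines" for e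
  proof -
    have "dir e \<notin> vec.span {p}"
    proof
      assume "dir e \<in> vec.span {p}"
      then obtain a where a: "dir e = a *s p" by (auto simp: vec.span_singleton)
      then have "a * p $ i = 0" using dir_i[of e] by simp
      then have "dir e = 0" using a i by simp
      then show False using dir_j[of e] dir_k[of e] by (auto split: option.splits)
    qed
    then have "vec.independent {dir e, p}" "dir e \<noteq> p"
      using p(2) vec.span_base[of p "{p}"] by (auto simp: vec.independent_insert)
    then have "vec.dim (W e) = 2"
      by (simp add: W_def insert_commute vec.dim_span_eq_card_independent del: vec.dim_span)
    then show ?thesis
      unfolding line_def pg2_lines_def by (intro CollectI exI[of _ "W e"]) (simp add: W_def)
  qed
  have P0_line: "P\<^sub>0 \<in> line e" for e
    unfolding line_def W_def p(3) using P0 p(3) by (auto intro: subsetD[OF vec.span_mono, rotated])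
  have cover: "\<exists>e. P \<in> line e" if P: "P \<in> pg2_points" for P
  proof -
    obtain w where w: "w \<in> P" "w \<noteq> 0" "P = vec.span {w}" using pg2_point_obtain[OF P] .
    define a where "a = w $ i / p $ i"
    define w' where "w' = w - a *s p"
    have w'_i: "w' $ i = 0" using i by (simp add: w'_def a_def)
    have "\<exists>e c. w' = c *s dir e"
    proof (cases "w' $ j = 0")
      case True
      then have "w' = w' $ k *s dir None"
        by (intro eqI) (simp_all add: w'_i dir_i dir_j dir_k)
      then show ?thesis by blast
    next
      case False
      then have "w' = w' $ j *s dir (Some (w' $ k / w' $ j))"
        by (intro eqI) (simp_all add: w'_i dir_i dir_j dir_k)
      then show ?thesis by blast
    qed
    then obtain e c where "w' = c *s dir e" by blast
    then have "w = a *s p + c *s dir e" by (simp add: w'_def diff_eq_eq add.commute)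
    then have "w \<in> W e" unfolding W_def span_pair_iff by blast
    then have "P \<subseteq> W e"
      unfolding w(3) W_def by (intro vec.span_minimal) auto
    then show ?thesis using P by (auto simp: line_def)
  qed
  have meet: "P = P\<^sub>0" if P: "P \<in> line e" "P \<in> line e'" "e \<noteq> e'" for P e e'
  proof -
    have Ppt: "P \<in> pg2_points" using P(1) by (simp add: line_def)
    obtain w where w: "w \<in> P" "w \<noteq> 0" "P = vec.span {w}" using pg2_point_obtain[OF Ppt] .
    have "w \<in> W e" "w \<in> W e'" using w(1) P by (auto simp: line_def)
    then obtain a c a' c' where ac: "w = a *s p + c *s dir e" and ac': "w = a' *s p + c' *s dir e'"
      unfolding W_def span_pair_iff by blast
    have "w $ i = a * p $ i" "w $ i = a' * p $ i"
      by (subst ac, simp add: dir_i) (subst ac', simp add: dir_i)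
    then have "a = a'" using i by simp
    then have "c *s dir e = c' *s dir e'" using ac ac' by simp
    then have "c = 0" using dir_inj P(3) by blast
    then have "w = a *s p" using ac by simp
    then have "w \<in> P\<^sub>0" unfolding p(3) by (auto simp: vec.span_singleton)
    then have "P\<^sub>0 = vec.span {w}" using pg2_point_eq_span[OF P0] w(2) by simp
    then show ?thesis using w(3) by simp
  qed
  have "K \<subseteq> (\<Union>e. line e)"
    using cover K(1) by auto
  then have "K = insert P\<^sub>0 (\<Union>e. line e \<inter> K - {P\<^sub>0})"
    using K(2) by auto
  then have "card K = card (insert P\<^sub>0 (\<Union>e. line e \<inter> K - {P\<^sub>0}))" by simp
  also have "\<dots> = 1 + card (\<Union>e. line e \<inter> K - {P\<^sub>0})"
    by (subst card_insert_disjoint) auto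
  also have "card (\<Union>e. line e \<inter> K - {P\<^sub>0}) = (\<Sum>e\<in>UNIV. card (line e \<inter> K - {P\<^sub>0}))"
    by (rule card_UN_disjoint) (use meet in auto)
  \<comment> \<open>Each line contains \<open>P\<^sub>0\<close>, a point of \<open>K\<close>, so the
    subtraction does not truncate.\<close>
  also have "\<dots> = (\<Sum>e\<in>UNIV. card (line e \<inter> K) - 1)"
    using P0_line K(2) by (intro sum.cong) (auto simp: card_Diff_subset)
  finally have "card K = 1 + (\<Sum>e\<in>UNIV. card (line e \<inter> K) - 1)" .
  then show ?thesis
    using line P0_line by (intro exI[of _ line] conjI allI)
qed

text \<open>The last two bounds come from a pencil through a point of \<open>K\<close>: each of its
  q + 1 lines meets \<open>K\<close>.\<close>

lemma secant_bounds:
  fixes K :: "('k::{field, finite} ^ 3) set set"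
  assumes "K \<subseteq> pg2_points" "K \<noteq> {}"
  shows "1 \<le> min_secant K" "min_secant K \<le> max_secant K"
    "1 + (CARD('k) + 1) * (min_secant K - 1) \<le> card K"
    "card K \<le> 1 + (CARD('k) + 1) * (max_secant K - 1)"
proof -
  obtain P\<^sub>0 where P0: "P\<^sub>0 \<in> K" using assms(2) by blast
  obtain line :: "'k option \<Rightarrow> _" where pencil: "(\<forall>e. line e \<in> pg2_lines \<and> P\<^sub>0 \<in> line e)
      \<and> card K = 1 + (\<Sum>e\<in>UNIV. card (line e \<inter> K) - 1)"
    using card_eq_sum_over_pencil[OF assms(1) P0] by (rule exE)
  then have line: "\<And>e. line e \<in> pg2_lines" "\<And>e. P\<^sub>0 \<in> line e"
    and card: "card K = 1 + (\<Sum>e\<in>UNIV. card (line e \<inter> K) - 1)"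
    by simp_all
  have lower: "min_secant K \<le> card (line e \<inter> K)" for e
    using line[of e] P0 by (intro min_secant_le_card) auto
  have upper: "card (line e \<inter> K) \<le> max_secant K" for e
    using line(1) by (rule card_le_max_secant)
  show "min_secant K \<le> max_secant K"
    using lower upper le_trans by blast
  have "line None \<in> lines_meeting K"
    using line P0 by (auto simp: lines_meeting_def)
  then have "min_secant K \<in> (\<lambda>l. card (l \<inter> K)) ` lines_meeting K"
    unfolding min_secant_def by (intro Min_in) auto
  then show "1 \<le> min_secant K"
    by (auto simp: lines_meeting_def Suc_le_eq card_gt_0_iff)
  have "(\<Sum>e\<in>(UNIV :: 'k option set). min_secant K - 1) \<le> (\<Sum>e\<in>UNIV. card (line e \<inter> K) - 1)"
    by (intro sum_mono diff_le_mono lower)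
  then show "1 + (CARD('k) + 1) * (min_secant K - 1) \<le> card K"
    unfolding card by (simp add: card_UNIV_option)
  have "(\<Sum>e\<in>UNIV. card (line e \<inter> K) - 1) \<le> (\<Sum>e\<in>(UNIV :: 'k option set). max_secant K - 1)"
    by (intro sum_mono diff_le_mono upper)
  then show "card K \<le> 1 + (CARD('k) + 1) * (max_secant K - 1)"
    unfolding card by (simp add: card_UNIV_option)
qed

section \<open>Curves through a point set\<close>

text \<open>The affine equation in the chart where the third coordinate is 1.\<close>

definition dehom :: "'a::field ternary_poly \<Rightarrow> 'a poly poly" where
  "dehom F = (\<Sum>m\<in>Poly_Mapping.keys F.
     Polynomial.smult [:Poly_Mapping.lookup F m:] (mono2 (Poly_Mapping.lookup m 1, Poly_Mapping.lookup m 2)))"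

lemma prod_UNIV_3: "prod f (UNIV :: 3 set) = f 1 * f 2 * f 3" for f :: "3 \<Rightarrow> 'a::comm_monoid_mult"
  unfolding UNIV_3 by (simp add: ac_simps)

lemma ev2_mono2: "ev2 (mono2 (i, j)) a b = a ^ i * b ^ j"
  by (simp add: mono2_def ev2_def poly_monom)

lemma ev2_dehom:
  fixes x :: "'a::field ^ 3"
  assumes "x $ 3 = 1"
  shows "ev2 (dehom F) (x $ 1) (x $ 2) = eval_poly3 F x"
proof -
  have "(\<Prod>i\<in>UNIV. (x $ i) ^ Poly_Mapping.lookup m i)
    = x $ 1 ^ Poly_Mapping.lookup m 1 * x $ 2 ^ Poly_Mapping.lookup m 2" for m
    by (simp only: prod_UNIV_3 assms power_one mult_1_right)
  then show ?thesis
    by (simp add: dehom_def ev2_sum ev2_mono2 eval_poly3_def)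
qed

lemma tdeg_dehom_le:
  assumes "form_of_degree d F"
  shows "tdeg (dehom F) \<le> d"
  unfolding dehom_def
proof (rule tdeg_sum_le)
  fix m assume "m \<in> Poly_Mapping.keys F"
  then have "(\<Sum>i\<in>UNIV. Poly_Mapping.lookup m i) = d"
    using assms by (simp add: form_of_degree_def)
  then have "Poly_Mapping.lookup m 1 + Poly_Mapping.lookup m 2 \<le> d"
    by (simp add: sum_3)
  then have "tdeg (mono2 (Poly_Mapping.lookup m 1, Poly_Mapping.lookup m 2) :: 'a poly poly) \<le> d"
    by (rule le_trans[OF tdeg_mono2_le])
  then have "tdeg ([:[:Poly_Mapping.lookup F m:]:] * mono2 (Poly_Mapping.lookup m 1, Poly_Mapping.lookup m 2)) \<le> 0 + d"
    by (intro tdeg_mult_le') simp_all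
  then show "tdeg (Polynomial.smult [:Poly_Mapping.lookup F m:] (mono2 (Poly_Mapping.lookup m 1, Poly_Mapping.lookup m 2))) \<le> d"
    by simp
qed

text \<open>In a form the first two exponents determine the third, so distinct monomials stay
  distinct and cannot cancel.\<close>

lemma dehom_nonzero:
  assumes "form_of_degree d F"
  shows "dehom F \<noteq> 0"
proof
  assume 0: "dehom F = 0"
  have "F \<noteq> 0" using assms by (simp add: form_of_degree_def)
  then obtain m where m: "m \<in> Poly_Mapping.keys F" by (metis ex_in_conv keys_eq_empty)
  have uniq: "m' = m" if "m' \<in> Poly_Mapping.keys F"
    "Poly_Mapping.lookup m' 1 = Poly_Mapping.lookup m 1" "Poly_Mapping.lookup m' 2 = Poly_Mapping.lookup m 2" for m'
  proof (rule poly_mapping_eqI)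
    fix i :: 3
    have "(\<Sum>i\<in>UNIV. Poly_Mapping.lookup m' i) = (\<Sum>i\<in>UNIV. Poly_Mapping.lookup m i)"
      using assms m that(1) by (simp add: form_of_degree_def)
    then show "Poly_Mapping.lookup m' i = Poly_Mapping.lookup m i"
      using that(2,3) exhaust_3[of i] by (auto simp: sum_3)
  qed
  have "cf (dehom F) (Poly_Mapping.lookup m 1) (Poly_Mapping.lookup m 2)
    = (\<Sum>m'\<in>Poly_Mapping.keys F. if m' = m then Poly_Mapping.lookup F m else 0)"
    unfolding dehom_def Polynomial.coeff_sum
    by (intro sum.cong) (use uniq in \<open>auto simp: mono2_def\<close>)
  also have "\<dots> = Poly_Mapping.lookup F m" using m by simp
  finally show False
    using 0 m by (simp add: in_keys_iff)
qed

lemma linear_form_eval: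
  assumes "form_of_degree 1 F"
  shows "\<exists>c. (\<exists>i. c i \<noteq> 0) \<and> (\<forall>x. eval_poly3 F x = (\<Sum>i\<in>UNIV. c i * x $ i))"
proof -
  define s :: "3 \<Rightarrow> (3 \<Rightarrow>\<^sub>0 nat)" where "s = (\<lambda>i. Poly_Mapping.single i 1)"
  have inj: "inj s"
  proof (rule injI)
    fix i j assume "s i = s j"
    then have "Poly_Mapping.lookup (s i) i = Poly_Mapping.lookup (s j) i" by simp
    then show "i = j" by (auto simp: s_def lookup_single when_def split: if_splits)
  qed
  have "\<exists>i. m = s i" if "m \<in> Poly_Mapping.keys F" for m
  proof -
    have sum: "(\<Sum>i\<in>UNIV. Poly_Mapping.lookup m i) = 1"
      using assms that by (simp add: form_of_degree_def)
    have "\<not> (\<forall>i\<in>UNIV. Poly_Mapping.lookup m i = 0)"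
    proof
      assume "\<forall>i\<in>UNIV. Poly_Mapping.lookup m i = 0"
      then have "(\<Sum>i\<in>UNIV. Poly_Mapping.lookup m i) = 0" by (rule sum.neutral)
      with sum show False by simp
    qed
    then obtain i where i: "Poly_Mapping.lookup m i \<noteq> 0" by blast
    have split: "(\<Sum>i\<in>UNIV. Poly_Mapping.lookup m i) = Poly_Mapping.lookup m i + (\<Sum>j\<in>UNIV - {i}. Poly_Mapping.lookup m j)"
      by (rule sum.remove) auto
    have "Poly_Mapping.lookup m i = 1" "(\<Sum>j\<in>UNIV - {i}. Poly_Mapping.lookup m j) = 0"
      using split sum i by linarith+
    then have "m = s i"
      by (intro poly_mapping_eqI) (auto simp: s_def lookup_single when_def)
    then show ?thesis by blast
  qed
  then have keys: "Poly_Mapping.keys F \<subseteq> range s" by blast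
  have prod: "(\<Prod>j\<in>UNIV. (x $ j) ^ Poly_Mapping.lookup (s i) j) = x $ i" for x :: "'a ^ 3" and i
  proof -
    have "(\<Prod>j\<in>UNIV. (x $ j) ^ Poly_Mapping.lookup (s i) j) = (\<Prod>j\<in>UNIV. if j = i then x $ j else 1)"
      by (intro prod.cong) (auto simp: s_def lookup_single when_def)
    then show ?thesis by simp
  qed
  have eval: "eval_poly3 F x = (\<Sum>i\<in>UNIV. Poly_Mapping.lookup F (s i) * x $ i)" for x
  proof -
    have "eval_poly3 F x = (\<Sum>m\<in>range s. Poly_Mapping.lookup F m * (\<Prod>i\<in>UNIV. (x $ i) ^ Poly_Mapping.lookup m i))"
      unfolding eval_poly3_def by (rule sum.mono_neutral_left) (use keys in \<open>auto simp: in_keys_iff\<close>)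
    then show ?thesis using inj by (simp add: sum.reindex prod)
  qed
  have "\<exists>i. Poly_Mapping.lookup F (s i) \<noteq> 0"
  proof -
    have "F \<noteq> 0" using assms by (simp add: form_of_degree_def)
    then obtain m where "m \<in> Poly_Mapping.keys F" by (metis ex_in_conv keys_eq_empty)
    then show ?thesis using keys by (auto simp: in_keys_iff)
  qed
  then show ?thesis
    by (intro exI[of _ "\<lambda>i. Poly_Mapping.lookup F (s i)"] conjI allI eval)
qed

definition vec_ac :: "'k::field ^ 3 \<Rightarrow> 'k alg_closure ^ 3" where
  "vec_ac v = (\<chi> i. to_ac (v $ i))"

lemma vec_ac_nth [simp]: "vec_ac v $ i = to_ac (v $ i)"
  by (simp add: vec_ac_def)

text \<open>A line over the algebraic closure, even an irrational one, cuts out a proper subspace of the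
  rational points.\<close>

lemma card_on_closure_line_le:
  fixes K :: "('k::{field, finite} ^ 3) set set" and c :: "3 \<Rightarrow> 'k alg_closure"
  assumes "K \<subseteq> pg2_points" "c i \<noteq> 0"
  shows "card {P \<in> K. \<forall>v\<in>P. (\<Sum>i\<in>UNIV. c i * vec_ac v $ i) = 0} \<le> max_secant K"
proof -
  define U where "U = {v. (\<Sum>i\<in>UNIV. c i * vec_ac v $ i) = 0}"
  have "vec.subspace U"
  proof (rule vec.subspaceI)
    show "0 \<in> U" by (simp add: U_def)
  next
    fix v w assume "v \<in> U" "w \<in> U"
    then show "v + w \<in> U" by (simp add: U_def ring_distribs sum.distrib)
  next
    fix a v assume v: "v \<in> U"
    have "(\<Sum>i\<in>UNIV. c i * vec_ac (a *s v) $ i) = to_ac a * (\<Sum>i\<in>UNIV. c i * vec_ac v $ i)"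
      by (simp add: sum_distrib_left mult_ac)
    then show "a *s v \<in> U" using v by (simp add: U_def)
  qed
  moreover have "axis i 1 \<notin> U"
  proof -
    have "(\<Sum>j\<in>UNIV. c j * vec_ac (axis i 1) $ j) = (\<Sum>j\<in>UNIV. if j = i then c j else 0)"
      by (intro sum.cong) (auto simp: axis_def)
    then show ?thesis using assms(2) by (simp add: U_def)
  qed
  then have "U \<noteq> UNIV" by blast
  ultimately have "card {P \<in> K. P \<subseteq> U} \<le> max_secant K"
    using assms(1) by (intro card_in_subspace_le_max_secant)
  moreover have "{P \<in> K. \<forall>v\<in>P. (\<Sum>i\<in>UNIV. c i * vec_ac v $ i) = 0} = {P \<in> K. P \<subseteq> U}"
    by (auto simp: U_def)
  ultimately show ?thesis by simp
qed

lemma ev2_tdeg_1: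
  assumes "tdeg l \<le> 1"
  shows "ev2 l a b = cf l 0 0 + cf l 1 0 * a + cf l 0 1 * b"
proof -
  have "exponents 1 = {(0, 0), (1, 0), (0, 1)}"
    by (auto simp: exponents_def)
  then have "l = Polynomial.smult [:cf l 0 0:] (mono2 (0, 0)) + (Polynomial.smult [:cf l 1 0:] (mono2 (1, 0)) + Polynomial.smult [:cf l 0 1:] (mono2 (0, 1)))"
    using tdeg_le_expand[OF assms] by simp
  then have "ev2 l a b = ev2 (Polynomial.smult [:cf l 0 0:] (mono2 (0, 0)) + (Polynomial.smult [:cf l 1 0:] (mono2 (1, 0)) + Polynomial.smult [:cf l 0 1:] (mono2 (0, 1)))) a b"
    by simp
  also have "\<dots> = cf l 0 0 + cf l 1 0 * a + cf l 0 1 * b"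
    by (simp only: ev2_simps ev2_mono2) simp
  finally show ?thesis .
qed

text \<open>Differentiate both sides of \<open>frobenius_to_ac\<close> for c = 1 and evaluate at 1:
  the left side gives 0 because q > 1, the right side gives q.\<close>

lemma of_nat_CARD_alg_closure: "of_nat CARD('k::{field, finite}) = (0 :: 'k alg_closure)"
proof -
  let ?q = "CARD('k)"
  have "card {0, 1 :: 'k} \<le> ?q" by (rule card_mono) simp_all
  then have q: "1 < ?q" by simp
  have "pderiv ([:- to_ac (1::'k), 1:] ^ ?q) = pderiv (Polynomial.monom 1 ?q - [:to_ac (1::'k):])"
    by (simp only: frobenius_to_ac)
  then have "poly (pderiv ([:- to_ac (1::'k), 1:] ^ ?q)) 1 = poly (pderiv (Polynomial.monom 1 ?q - [:to_ac (1::'k):])) 1"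
    by (rule arg_cong)
  then show ?thesis
    using q by (simp add: pderiv_power pderiv_diff pderiv_monom poly_monom pderiv_pCons power_0_left)
qed

text \<open>The term \<open>2 * max_secant K\<close> pays for the points at infinity, and the other
  one for those of the affine chart. The degree is only bounded by \<open>d\<close>, so that one
  value of \<open>d\<close> serves all smaller degrees.\<close>

lemma card_on_curve_bound:
  fixes K :: "('k::{field, finite} ^ 3) set set" and F :: "'k alg_closure ternary_poly"
  assumes K: "K \<subseteq> pg2_points" and F: "form_of_degree e F" "e \<le> d"
    and van: "\<And>P v. P \<in> K \<Longrightarrow> v \<in> P \<Longrightarrow> eval_poly3 F (vec_ac v) = 0"
    and M: "2 * max_secant K \<le> d + CARD('k) - 1" and q: "d * (d - 1) < CARD('k)"
  shows "2 * card K \<le> 2 * max_secant K + d * (d + CARD('k) - 1)"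
proof -
  let ?q = "CARD('k)"
  define H where "H = {P \<in> K. \<forall>v\<in>P. v $ 3 = 0}"
  define A where "A = K - H"
  have card: "card K = card A + card H"
  proof -
    have sub: "H \<subseteq> K" by (auto simp: H_def)
    then have "card A = card K - card H"
      unfolding A_def by (intro card_Diff_subset) simp_all
    then show ?thesis using card_mono[OF _ sub] by simp
  qed
  have H: "card H \<le> max_secant K"
  proof -
    define c :: "3 \<Rightarrow> 'k alg_closure" where "c = (\<lambda>i. if i = 3 then 1 else 0)"
    have "c i * x = (if i = 3 then x else 0)" for i x by (simp add: c_def)
    then have "H = {P \<in> K. \<forall>v\<in>P. (\<Sum>i\<in>UNIV. c i * vec_ac v $ i) = 0}"
      by (simp add: H_def)
    then show ?thesis
      using card_on_closure_line_le[OF K, of c 3] by (simp add: c_def)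
  qed
  define r where "r = (\<lambda>P :: ('k ^ 3) set. SOME v. v \<in> P \<and> v $ 3 = 1)"
  have r: "r P \<in> P" "r P $ 3 = 1" "P = vec.span {r P}" if "P \<in> A" for P
  proof -
    have P: "P \<in> pg2_points" "P \<in> K - H" using that K by (auto simp: A_def)
    then obtain v :: "'k ^ 3" where v: "v \<in> P" "v $ 3 \<noteq> 0" by (auto simp: H_def)
    have "(1 / v $ 3) *s v \<in> P" using P(1) v(1) by (auto simp: pg2_points_def intro: vec.subspace_scale)
    then have "\<exists>v. v \<in> P \<and> v $ 3 = 1" using v(2) by (intro exI[of _ "(1 / v $ 3) *s v"]) simp
    from someI_ex[OF this] show r1: "r P \<in> P" and r2: "r P $ 3 = 1" by (simp_all add: r_def)
    have "r P \<noteq> 0" using r2 by auto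
    then show "P = vec.span {r P}" by (rule pg2_point_eq_span[OF P(1) r1])
  qed
  define \<phi> where "\<phi> = (\<lambda>P. (to_ac (r P $ 1), to_ac (r P $ 2)))"
  have inj: "inj_on \<phi> A"
  proof (rule inj_onI)
    fix P Q assume PQ: "P \<in> A" "Q \<in> A" "\<phi> P = \<phi> Q"
    have "r P $ i = r Q $ i" for i
      using PQ r(2)[of P] r(2)[of Q] exhaust_3[of i] by (auto simp: \<phi>_def)
    then have rPQ: "r P = r Q" by (simp add: vec_eq_iff)
    have "P = vec.span {r P}" by (rule r(3)[OF PQ(1)])
    also have "\<dots> = vec.span {r Q}" by (simp only: rPQ)
    also have "\<dots> = Q" by (rule r(3)[OF PQ(2), symmetric])
    finally show "P = Q" .
  qed
  define f where "f = dehom F"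
  have f: "f \<noteq> 0" "tdeg f \<le> d"
    using dehom_nonzero[OF F(1)] tdeg_dehom_le[OF F(1)] F(2) by (simp_all add: f_def)
  have zero: "ev2 f (fst (\<phi> P)) (snd (\<phi> P)) = 0" if "P \<in> A" for P
  proof -
    have "ev2 f (vec_ac (r P) $ 1) (vec_ac (r P) $ 2) = eval_poly3 F (vec_ac (r P))"
      unfolding f_def by (rule ev2_dehom) (simp add: r(2)[OF that])
    also have "\<dots> = 0" using van[of P] r(1)[OF that] that by (simp add: A_def)
    finally show ?thesis by (simp add: \<phi>_def)
  qed
  define N where "N = \<phi> ` A"
  have "{(a, b) \<in> N. ev2 f a b = 0} = N"
  proof (rule Collect_cong[THEN trans[OF _ Collect_mem_eq]])
    fix x :: "'k alg_closure \<times> 'k alg_closure"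
    show "(case x of (a, b) \<Rightarrow> (a, b) \<in> N \<and> ev2 f a b = 0) \<longleftrightarrow> x \<in> N"
      using zero by (auto simp: N_def split_beta)
  qed
  moreover have "2 * card {(a, b) \<in> N. ev2 f a b = 0} \<le> tdeg f * (d + ?q - 1)"
  proof (rule card_rational_points_curve[OF _ _ _ _ _ _ _ q f])
    show "prime CHAR('k alg_closure)"
      using prime_CHAR_finite_field[where ?'k = 'k] by simp
    show "0 < ?q" by simp
    show "of_nat ?q = (0 :: 'k alg_closure)"
      by (rule of_nat_CARD_alg_closure)
    show "finite N" by (simp add: N_def)
    show "[:- a, 1:] ^ ?q = Polynomial.monom 1 ?q - [:a:]" "[:- b, 1:] ^ ?q = Polynomial.monom 1 ?q - [:b:]"
      if "(a, b) \<in> N" for a b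
      using that by (auto simp: N_def \<phi>_def frobenius_to_ac)
  next
    fix l :: "'k alg_closure poly poly" assume l: "tdeg l = 1"
    \<comment> \<open>The coefficients of the homogenisation of \<open>l\<close>; degree exactly 1
      makes one of the first two nonzero.\<close>
    define c where "c = (\<lambda>i::3. if i = 1 then cf l 1 0 else if i = 2 then cf l 0 1 else cf l 0 0)"
    have "c 1 \<noteq> 0 \<or> c 2 \<noteq> 0"
    proof (rule ccontr)
      assume *: "\<not> ?thesis"
      have "tdeg l \<le> 0"
        unfolding tdeg_le_iff
      proof (intro allI impI)
        fix i j :: nat assume "0 < i + j"
        then consider "1 < i + j" | "i = 1" "j = 0" | "i = 0" "j = 1" by linarith
        then show "cf l i j = 0"
          using * l tdeg_le_iff[of l 1] by cases (auto simp: c_def)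
      qed
      with l show False by simp
    qed
    then obtain i where i: "c i \<noteq> 0" by blast
    let ?S = "{P \<in> K. \<forall>v\<in>P. (\<Sum>i\<in>UNIV. c i * vec_ac v $ i) = 0}"
    have "{(a, b) \<in> N. ev2 l a b = 0} \<subseteq> \<phi> ` ?S"
    proof safe
      fix a b assume "(a, b) \<in> N" and ev: "ev2 l a b = 0"
      then obtain P where P: "P \<in> A" "(a, b) = \<phi> P" by (auto simp: N_def)
      have "(\<Sum>i\<in>UNIV. c i * vec_ac (r P) $ i) = ev2 l a b"
        using P(2) r(2)[OF P(1)] l by (simp add: ev2_tdeg_1 sum_3 c_def \<phi>_def)
      then have 0: "(\<Sum>i\<in>UNIV. c i * vec_ac (r P) $ i) = 0" using ev by simp
      have "(\<Sum>i\<in>UNIV. c i * vec_ac v $ i) = 0" if "v \<in> P" for v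
      proof -
        have "v \<in> vec.span {r P}" using that by (subst (asm) r(3)[OF P(1)])
        then obtain k where "v = k *s r P" by (auto simp: vec.span_singleton)
        then have "(\<Sum>i\<in>UNIV. c i * vec_ac v $ i) = to_ac k * (\<Sum>i\<in>UNIV. c i * vec_ac (r P) $ i)"
          by (simp add: sum_distrib_left mult_ac)
        then show ?thesis using 0 by simp
      qed
      then have "P \<in> ?S" using P(1) by (simp add: A_def)
      then show "(a, b) \<in> \<phi> ` ?S" using P(2) by blast
    qed
    then have "card {(a, b) \<in> N. ev2 l a b = 0} \<le> card (\<phi> ` ?S)"
      by (rule card_mono[rotated]) simp
    also have "\<dots> \<le> card ?S" by (rule card_image_le) simp
    also have "\<dots> \<le> max_secant K" by (rule card_on_closure_line_le[where c = c, OF K i])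
    finally show "2 * card {(a, b) \<in> N. ev2 l a b = 0} \<le> d + ?q - 1" using M by simp
  qed
  ultimately have "2 * card N \<le> tdeg f * (d + ?q - 1)" by simp
  also have "\<dots> \<le> d * (d + ?q - 1)" using f(2) by (rule mult_le_mono1)
  finally show ?thesis
    using card H card_image[OF inj] by (simp add: N_def)
qed

text \<open>Settles t = 1, where a curve of degree below 2t is a line.\<close>

lemma card_on_linear_form_bound:
  fixes K :: "('k::{field, finite} ^ 3) set set" and F :: "'k alg_closure ternary_poly"
  assumes K: "K \<subseteq> pg2_points" and F: "form_of_degree 1 F"
    and van: "\<And>P v. P \<in> K \<Longrightarrow> v \<in> P \<Longrightarrow> eval_poly3 F (vec_ac v) = 0"
  shows "card K \<le> max_secant K"
proof -
  obtain c i where c: "c i \<noteq> 0" "\<And>x. eval_poly3 F x = (\<Sum>i\<in>UNIV. c i * x $ i)"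
    using linear_form_eval[OF F] by metis
  have "{P \<in> K. \<forall>v\<in>P. (\<Sum>i\<in>UNIV. c i * vec_ac v $ i) = 0} = K"
    using van c(2) by auto
  then show ?thesis
    using card_on_closure_line_le[where c = c, OF K c(1)] by simp
qed

section \<open>The numerical conditions\<close>

text \<open>With d = 2t - 1 the conclusions are the condition on lines, the condition d (d - 1) < q
  on nonclassical components, and the contradiction with the size of the point set. The pencil
  bounds supply m \<le> t + 1 and t \<le> M.\<close>

lemma first_bound_arith:
  fixes q t \<alpha> m M :: int
  assumes "2 \<le> t" "t \<le> q" "0 \<le> \<alpha>" "\<alpha> < q" "1 \<le> m" "m \<le> M"
    and lo: "1 + (q + 1) * (m - 1) \<le> q * t + \<alpha>" and hi: "q * t + \<alpha> \<le> 1 + (q + 1) * (M - 1)"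
    and q: "q > 8 * t^3 - 16 * t^2 + 2 * t + 4 - 2 * m * (2 * t^2 - 5 * t + 2) + 2 * M * (2 * t - 1)"
  shows "2 * M \<le> 2 * t - 2 + q" "(2 * t - 1) * (2 * t - 2) < q"
    "2 * M + (2 * t - 1) * (2 * t - 2 + q) < 2 * (q * t + \<alpha>)"
proof -
  have m: "m \<le> t + 1"
  proof (rule ccontr)
    assume "\<not> m \<le> t + 1"
    then have "(q + 1) * (t + 1) \<le> (q + 1) * (m - 1)"
      using assms(1-2) by (intro mult_left_mono) auto
    then show False using lo assms(2-4) assms(1) by (simp add: algebra_simps)
  qed
  have M: "t \<le> M"
  proof (rule ccontr)
    assume "\<not> t \<le> M"
    then have "(q + 1) * (M - 1) \<le> (q + 1) * (t - 2)"
      using assms(1-2) by (intro mult_left_mono) auto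
    then show False using hi assms(1-4) by (simp add: algebra_simps)
  qed
  \<comment> \<open>This coefficient of m is (2t - 1)(t - 2); its sign for t \<ge> 2 allows m to be
    replaced by t + 1.\<close>
  have nn: "0 \<le> 2 * t^2 - 5 * t + 2"
  proof -
    have "0 \<le> (2 * t - 1) * (t - 2)" using assms(1) by simp
    then show ?thesis by (simp add: algebra_simps power2_eq_square)
  qed
  have "m * (2 * t^2 - 5 * t + 2) \<le> (t + 1) * (2 * t^2 - 5 * t + 2)"
    using m nn by (intro mult_right_mono)
  then have q1: "q > 4 * t^3 - 10 * t^2 + 8 * t + 2 * M * (2 * t - 1)"
    using q by (simp add: algebra_simps power2_eq_square power3_eq_cube)
  have "2 * M * 3 \<le> 2 * M * (2 * t - 1)"
    using M assms(1) by (intro mult_left_mono) auto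
  moreover have "0 \<le> 4 * t^3 - 10 * t^2 + 8 * t"
  proof -
    have "4 * t^3 - 10 * t^2 + 8 * t = 2 * t * ((t - 2) * (2 * t - 1) + 2)"
      by (simp add: algebra_simps power2_eq_square power3_eq_cube)
    also have "\<dots> \<ge> 0" using assms(1) by (intro mult_nonneg_nonneg add_nonneg_nonneg) auto
    finally show ?thesis .
  qed
  ultimately have "2 * M * 3 < q" using q1 by linarith
  then show "2 * M \<le> 2 * t - 2 + q" using M assms(1) by linarith
  \<comment> \<open>In s = t - 2 the polynomial to be estimated has nonnegative coefficients
    only.\<close>
  obtain s where s: "t = s + 2" "0 \<le> s" using assms(1) by (metis add.commute diff_add_cancel diff_ge_0_iff_ge)
  have "2 * M * (2 * t - 2) \<ge> 2 * t * (2 * t - 2)"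
    using M assms(1) by (intro mult_right_mono) auto
  moreover have "4 * t^3 - 10 * t^2 + 8 * t + 2 * t * (2 * t - 2) \<ge> (2 * t - 1) * (2 * t - 2)"
  proof -
    have "4 * t^3 - 10 * t^2 + 8 * t + 2 * t * (2 * t - 2) - (2 * t - 1) * (2 * t - 2) = 4 * s ^ 3 + 14 * s\<^sup>2 + 18 * s + 10"
      by (simp add: s(1) algebra_simps power2_eq_square power3_eq_cube)
    moreover have "0 \<le> 4 * s ^ 3 + 14 * s\<^sup>2 + 18 * s + 10" using s(2) by simp
    ultimately show ?thesis by linarith
  qed
  ultimately have main: "(2 * t - 1) * (2 * t - 2) + 2 * M < q"
    using q1 by (simp add: algebra_simps)
  then show "(2 * t - 1) * (2 * t - 2) < q" using M assms(1) by linarith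
  show "2 * M + (2 * t - 1) * (2 * t - 2 + q) < 2 * (q * t + \<alpha>)"
    using main assms(3) by (simp add: algebra_simps)
qed

text \<open>For the first two conclusions \<alpha> < q turns the hypothesis into a lower bound on 3
  q, whence the factors 3; the last one uses q + 2 \<alpha> as it stands.\<close>

lemma second_bound_arith:
  fixes q t \<alpha> M :: int
  assumes "2 \<le> t" "t \<le> q" "0 \<le> \<alpha>" "\<alpha> < q" "1 \<le> M"
    and hi: "q * t + \<alpha> \<le> 1 + (q + 1) * (M - 1)"
    and q: "q > 8 * t^2 - 16 * t + 8 - 2 * \<alpha> + 2 * M * (2 * t - 1)"
  shows "2 * M \<le> 2 * t - 2 + q" "(2 * t - 1) * (2 * t - 2) < q"
    "2 * M + (2 * t - 1) * (2 * t - 2 + q) < 2 * (q * t + \<alpha>)"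
proof -
  have M: "t + 1 \<le> M"
  proof (rule ccontr)
    assume "\<not> t + 1 \<le> M"
    then have "(q + 1) * (M - 1) \<le> (q + 1) * (t - 1)"
      using assms(1-2) by (intro mult_left_mono) auto
    then have "q + \<alpha> \<le> t" using hi by (simp add: algebra_simps)
    \<comment> \<open>This extreme case is excluded by the numerical hypothesis.\<close>
    then have "q = t" "\<alpha> = 0" using assms(2,3) by auto
    have "2 * M * (2 * t - 1) \<ge> 0" using assms(1,5) by simp
    then have "8 * t^2 - 16 * t + 8 < t" using q \<open>q = t\<close> \<open>\<alpha> = 0\<close> by linarith
    moreover have "8 * t^2 - 16 * t + 8 - t = (t - 2) * (8 * t - 1) + 6"
      by (simp add: algebra_simps power2_eq_square)
    moreover have "0 \<le> (t - 2) * (8 * t - 1)" using assms(1) by simp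
    ultimately show False by linarith
  qed
  have sq: "8 * t^2 - 16 * t + 8 = 8 * (t - 1)^2"
    by (simp add: algebra_simps power2_eq_square)
  have "2 * M * 3 \<le> 2 * M * (2 * t - 1)"
    using M assms(1) by (intro mult_left_mono) auto
  moreover have "0 \<le> 8 * (t - 1)^2" by simp
  ultimately have "2 * M * 3 < 3 * q" using q sq assms(4) by linarith
  then show "2 * M \<le> 2 * t - 2 + q" using assms(1) by linarith
  have "2 * M * (2 * t - 1) \<ge> 2 * (t + 1) * (2 * t - 1)"
    using M assms(1) by (intro mult_right_mono) auto
  then have "8 * t^2 - 16 * t + 8 + 2 * (t + 1) * (2 * t - 1) < 3 * q"
    using q assms(4) by linarith
  moreover have "3 * ((2 * t - 1) * (2 * t - 2)) \<le> 8 * t^2 - 16 * t + 8 + 2 * (t + 1) * (2 * t - 1)"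
    using assms(1) by (simp add: algebra_simps power2_eq_square)
  ultimately show "(2 * t - 1) * (2 * t - 2) < q" by linarith
  have "2 * M * (2 * t - 2) \<ge> 0" using assms(1,5) by simp
  moreover have "(2 * t - 1) * (2 * t - 2) \<le> 8 * t^2 - 16 * t + 8 + 2 * (2 * t - 2)"
  proof -
    have "8 * t^2 - 16 * t + 8 + 2 * (2 * t - 2) - (2 * t - 1) * (2 * t - 2) = (2 * t - 2) * (2 * t - 1)"
      by (simp add: algebra_simps power2_eq_square)
    moreover have "0 \<le> (2 * t - 2) * (2 * t - 1)" using assms(1) by simp
    ultimately show ?thesis by linarith
  qed
  moreover have "2 * M * (2 * t - 2) \<ge> 2 * (2 * t - 2)"
    using assms(1,5) by (intro mult_right_mono) auto
  ultimately have "(2 * t - 1) * (2 * t - 2) + 2 * M < q + 2 * \<alpha>"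
    using q by (simp add: algebra_simps)
  then show "2 * M + (2 * t - 1) * (2 * t - 2 + q) < 2 * (q * t + \<alpha>)"
    by (simp add: algebra_simps)
qed

theorem theorem3p2:
  fixes q :: nat and t \<alpha> m\<^sub>0 M\<^sub>0 :: int
    and K :: "('k::{field, finite} ^ 3) set set"
    and \<Gamma> :: "('k alg_closure ^ 3) set set"
  assumes "CARD('k) = q"
    and "0 \<le> t" and "t \<le> int q" and "0 \<le> \<alpha>" and "\<alpha> < int q"
    and "K \<subseteq> pg2_points" and "int (card K) = int q * t + \<alpha>"
    and "m\<^sub>0 = int (min_secant K)" and "M\<^sub>0 = int (max_secant K)"
    and "is_arg_min curve_degree (\<lambda>C. plane_curve C \<and> (\<forall>P\<in>K. passes_through C P)) \<Gamma>"
  shows "(int q > 8 * t^3 - 16 * t^2 + 2 * t + 4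
                    - 2 * m\<^sub>0 * (2 * t^2 - 5 * t + 2) + 2 * M\<^sub>0 * (2 * t - 1)
            \<longrightarrow> int (curve_degree \<Gamma>) \<ge> 2 * t)
       \<and> (Factorial_Ring.prime q \<and> int q > 8 * t^2 - 16 * t + 8 - 2 * \<alpha> + 2 * M\<^sub>0 * (2 * t - 1)
            \<longrightarrow> int (curve_degree \<Gamma>) \<ge> 2 * t)"
proof -
  have \<Gamma>: "plane_curve \<Gamma>" "\<And>P. P \<in> K \<Longrightarrow> passes_through \<Gamma> P"
    using assms(10) by (auto simp: is_arg_min_def)
  define e where "e = curve_degree \<Gamma>"
  \<comment> \<open>The least degree is attained, so the curve has an equation of degree exactly
    \<open>e\<close>.\<close>
  have "e \<ge> 1 \<and> (\<exists>F. form_of_degree e F \<and> \<Gamma> = zero_locus F)"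
    unfolding e_def curve_degree_def
    by (rule LeastI_ex) (use \<Gamma>(1) in \<open>auto simp: plane_curve_def\<close>)
  then obtain F where e: "e \<ge> 1" and F: "form_of_degree e F" "\<Gamma> = zero_locus F"
    by blast
  have van: "eval_poly3 F (vec_ac v) = 0" if "P \<in> K" "v \<in> P" for P v
  proof -
    have "point_to_ac P \<in> zero_locus F"
      using \<Gamma>(2)[OF that(1)] F(2) by (simp add: passes_through_def)
    moreover have "vec_ac v \<in> point_to_ac P"
      unfolding point_to_ac_def vec_ac_def using that(2) by (intro vec.span_base imageI)
    ultimately show ?thesis by (simp add: zero_locus_def)
  qed
  have False if le: "int e < 2 * t"
    and cond: "(int q > 8 * t^3 - 16 * t^2 + 2 * t + 4
                    - 2 * m\<^sub>0 * (2 * t^2 - 5 * t + 2) + 2 * M\<^sub>0 * (2 * t - 1))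
      \<or> int q > 8 * t^2 - 16 * t + 8 - 2 * \<alpha> + 2 * M\<^sub>0 * (2 * t - 1)"
  proof -
    have t: "1 \<le> t" using le by linarith
    have "q > 0" using assms(1) by (metis zero_less_card_finite)
    have "int q * 1 \<le> int q * t" using t by (intro mult_left_mono) auto
    then have "int (card K) > 0"
      using assms(4,7) \<open>q > 0\<close> by linarith
    \<comment> \<open>Here t \<ge> 1 matters: it makes the minimum and maximum of secant sizes range
      over a nonempty set.\<close>
    then have "K \<noteq> {}" by auto
    note bounds = secant_bounds[OF assms(6) \<open>K \<noteq> {}\<close>]
    have int_eq: "int (1 + (CARD('k) + 1) * (n - 1)) = 1 + (int q + 1) * (int n - 1)" if "1 \<le> n" for n
      by (simp only: of_nat_add of_nat_mult of_nat_1 assms(1) of_nat_diff[OF that])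
    have "1 \<le> max_secant K"
      using bounds(1,2) by linarith
    then have sec: "1 \<le> m\<^sub>0" "m\<^sub>0 \<le> M\<^sub>0" "1 + (int q + 1) * (m\<^sub>0 - 1) \<le> int q * t + \<alpha>"
      "int q * t + \<alpha> \<le> 1 + (int q + 1) * (M\<^sub>0 - 1)"
      using bounds unfolding assms(7)[symmetric] assms(8,9)
      by (simp_all only: int_eq[symmetric] of_nat_le_iff)
    show False
    \<comment> \<open>For t = 1 the coefficient (2t - 1)(t - 2) is negative, which reverses the
      estimate of m_0. But then |K| = q + \<alpha> \<le> M_0, while the conditions read q > 2 M_0 +
      2 m_0 - 2 and q > 2 M_0 - 2 \<alpha>.\<close>
    proof (cases "t = 1")
      case True
      then have "e = 1" using e le by linarith
      have "card K \<le> max_secant K"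
        using F(1) van unfolding \<open>e = 1\<close> by (intro card_on_linear_form_bound[OF assms(6)])
      then have "int q + \<alpha> \<le> M\<^sub>0"
        using assms(7) True by (simp add: assms(9))
      then show False
        using cond True sec assms(4,5) by auto
    next
      case False
      then have t2: "2 \<le> t" using t by linarith
      \<comment> \<open>The largest degree below 2t.\<close>
      define d where "d = nat (2 * t - 1)"
      have d: "int d = 2 * t - 1" "int (d - 1) = 2 * t - 2" using t2 by (simp_all add: d_def)
      have "2 * M\<^sub>0 \<le> 2 * t - 2 + int q \<and> (2 * t - 1) * (2 * t - 2) < int q
        \<and> 2 * M\<^sub>0 + (2 * t - 1) * (2 * t - 2 + int q) < 2 * (int q * t + \<alpha>)"
        using cond first_bound_arith[OF t2 assms(3,4,5) sec(1,2,3,4)]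
          second_bound_arith[OF t2 assms(3,4,5) _ sec(4)] sec(1,2) by auto
      then have arith: "2 * M\<^sub>0 \<le> 2 * t - 2 + int q" "(2 * t - 1) * (2 * t - 2) < int q"
        "2 * M\<^sub>0 + (2 * t - 1) * (2 * t - 2 + int q) < 2 * (int q * t + \<alpha>)" by auto
      have dq: "int (d + CARD('k) - 1) = 2 * t - 2 + int q"
        using d assms(1) t2 by linarith
      have "2 * card K \<le> 2 * max_secant K + d * (d + CARD('k) - 1)"
      proof (rule card_on_curve_bound[OF assms(6) F(1) _ van])
        show "e \<le> d" using le d(1) by linarith
        have "int (2 * max_secant K) \<le> int (d + CARD('k) - 1)"
          unfolding dq using arith(1) by (simp add: assms(9))
        then show "2 * max_secant K \<le> d + CARD('k) - 1" by (simp only: of_nat_le_iff)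
        have "int (d * (d - 1)) < int CARD('k)"
          unfolding of_nat_mult d assms(1) by (rule arith(2))
        then show "d * (d - 1) < CARD('k)" by (simp only: of_nat_less_iff)
      qed
      then have "int (2 * card K) \<le> int (2 * max_secant K + d * (d + CARD('k) - 1))"
        by (simp only: of_nat_le_iff)
      then have "2 * int (card K) \<le> 2 * M\<^sub>0 + (2 * t - 1) * (2 * t - 2 + int q)"
        unfolding of_nat_add of_nat_mult d dq by (simp add: assms(9))
      then show False using arith(3) unfolding assms(7) by (meson leD)
    qed
  qed
  then show ?thesis
    unfolding e_def by (meson not_le)
qed

end
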